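(* Let $\mu=ID(A,L,b)_h$ be an infinitely divisible distribution on $\mathbb R^d$, and let $g:\mathbb R^d\to[0,\infty)$ be a Borel function such that (A1) $0\le g(x)\le 1$ for all $x\in\mathbb R^d$, and (A2) $\int_{\mathbb R^d}\left(|xh(x)|\vee 1\right)(1-g(x))\,L(\mathrm dx)<\infty$. Let $\tilde L(\mathrm dx)=g(x)L(\mathrm dx)$, $\tilde b=b-\int_{\mathbb R^d}xh(x)(1-g(x))\,L(\mathrm dx)$, and $\tilde\mu=ID(A,\tilde L,\tilde b)_h$. Let $\rho(\mathrm dx)=(1-g(x))L(\mathrm dx)$ and $\eta=\rho(\mathbb R^d)<\infty$. Let $V=\{V_t:t\ge0\}$ be the compound Poisson process $V_t=\sum_{i=1}^{N_t}Z_i$, where $Z_1,Z_2,\dots$ are iid with distribution $\rho_1=\rho/\eta$ and, independent of these, $\{N_t:t\ge0\}$ is a Poisson process with intensity $\eta$; let $T=\inf\{t:N_t>0\}$. (If $\eta=0$, set $V_t=0$ for all $t$ and $T=\infty$.) Let $\tilde X=\{\tilde X_t:t\ge0\}$ be a L\'evy process, independent of $V$, with $\tilde X_1\sim\tilde\mu$, and set $$X_t=\tilde X_t+V_t,\qquad t\ge0.$$ Then: 1. The process $X=\{X_t:t\ge0\}$ is a L\'evy process with $X_1\sim\mu$. 2. If $0\le t<T$, then $X_t=\tilde X_t$. 3. For any Borel set $B\subset\mathbb R^d$ and any $t\ge0$, $$P(\tilde X_t\in B)\le e^{t\eta}P(X_t\in B).$$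
   Context: $\mathbb R^d$ carries the usual inner product $\langle\cdot,\cdot\rangle$ and norm $|\cdot|$; $a\vee b=\max(a,b)$, $a\wedge b=\min(a,b)$; $X\sim\mu$ means $X$ has distribution $\mu$. $ID(A,L,b)_h$ denotes the infinitely divisible probability measure on $\mathbb R^d$ with characteristic function $\phi_\mu(z)=\exp\{C_\mu(z)\}$, where $$C_\mu(z)=-\tfrac12\langle z,Az\rangle+i\langle b,z\rangle+\int_{\mathbb R^d}\left(e^{i\langle z,x\rangle}-1-i\langle z,x\rangle h(x)\right)L(\mathrm dx),\quad z\in\mathbb R^d.$$ Here $A$ is a symmetric nonnegative-definite $d\times d$ matrix, $b\in\mathbb R^d$, $L$ is a Borel measure on $\mathbb R^d$ (the L\'evy measure) with $L(\{0\})=0$ and $\int_{\mathbb R^d}(|x|^2\wedge1)L(\mathrm dx)<\infty$, and $h:\mathbb R^d\to\mathbb R$ is a Borel function (the $h$-function) with $\int_{\mathbb R^d}|e^{i\langle z,x\rangle}-1-i\langle z,x\rangle h(x)|L(\mathrm dx)<\infty$ for all $z\in\mathbb R^d$. Under (A1), $\tilde L$ is a valid L\'evy measure and the same $h$ can be used with $\tilde L$. A L\'evy process $\{X_t:t\ge0\}$ with $X_1\sim\mu$ starts at $0$, is stochastically continuous, has independent and stationary increments, and $X_t$ has characteristic function $(\phi_\mu(z))^t$. *)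

theory Defs
  imports "HOL-Probability.Probability"
begin

definition char_fn :: "(real ^ 'n) measure \<Rightarrow> real ^ 'n \<Rightarrow> complex" where
  "char_fn \<mu> z = (CLINT x|\<mu>. iexp (z \<bullet> x))"

definition covariance_matrix :: "real ^ 'n ^ 'n \<Rightarrow> bool" where
  "covariance_matrix A \<longleftrightarrow> transpose A = A \<and> (\<forall>z. 0 \<le> z \<bullet> (A *v z))"

definition levy_measure :: "(real ^ 'n) measure \<Rightarrow> bool" where
  "levy_measure L \<longleftrightarrow> sets L = sets borel \<and> emeasure L {0} = 0 \<and>
     (\<integral>\<^sup>+ x. ennreal (min ((norm x)\<^sup>2) 1) \<partial>L) < \<infinity>"

definition h_function :: "(real ^ 'n) measure \<Rightarrow> (real ^ 'n \<Rightarrow> real) \<Rightarrow> bool" where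
  "h_function L h \<longleftrightarrow> h \<in> borel_measurable borel \<and>
     (\<forall>z. (\<integral>\<^sup>+ x. ennreal (cmod (iexp (z \<bullet> x) - 1 - \<i> * complex_of_real ((z \<bullet> x) * h x))) \<partial>L) < \<infinity>)"

definition levy_exponent ::
  "real ^ 'n ^ 'n \<Rightarrow> (real ^ 'n) measure \<Rightarrow> real ^ 'n \<Rightarrow> (real ^ 'n \<Rightarrow> real) \<Rightarrow> real ^ 'n \<Rightarrow> complex" where
  "levy_exponent A L b h z =
     - complex_of_real (z \<bullet> (A *v z)) / 2 + \<i> * complex_of_real (b \<bullet> z) +
     (CLINT x|L. iexp (z \<bullet> x) - 1 - \<i> * complex_of_real ((z \<bullet> x) * h x))"

definition infinitely_divisible :: "(real ^ 'n) measure \<Rightarrow> bool" where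
  "infinitely_divisible \<mu> \<longleftrightarrow>
     (\<forall>n\<ge>1. \<exists>\<nu>. prob_space \<nu> \<and> sets \<nu> = sets borel \<and>
        \<mu> = (convolution \<nu> ^^ n) (return borel 0))"

text \<open>
  The measure \<open>ID(A,L,b)\<^sub>h\<close> is rendered as a predicate on \<open>\<mu>\<close>. It is intended for parameters
  satisfying \<^const>\<open>covariance_matrix\<close>, \<^const>\<open>levy_measure\<close> and \<^const>\<open>h_function\<close>.
\<close>

definition is_ID ::
  "real ^ 'n ^ 'n \<Rightarrow> (real ^ 'n) measure \<Rightarrow> real ^ 'n \<Rightarrow> (real ^ 'n \<Rightarrow> real) \<Rightarrow> (real ^ 'n) measure \<Rightarrow> bool" where
  "is_ID A L b h \<mu> \<longleftrightarrow> prob_space \<mu> \<and> sets \<mu> = sets borel \<and> infinitely_divisible \<mu> \<and>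
     (\<forall>z. char_fn \<mu> z = exp (levy_exponent A L b h z))"

definition process_events ::
  "'w measure \<Rightarrow> 'i set \<Rightarrow> ('i \<Rightarrow> 'w \<Rightarrow> 'b::topological_space) \<Rightarrow> 'w set set" where
  "process_events M I Y =
     sigma_sets (space M) (\<Union>i\<in>I. {Y i -` B \<inter> space M | B. B \<in> sets borel})"

definition independent_increments ::
  "'w measure \<Rightarrow> (real \<Rightarrow> 'w \<Rightarrow> 'b::{topological_space, minus}) \<Rightarrow> bool" where
  "independent_increments M X \<longleftrightarrow>
     (\<forall>(n::nat) (t::nat \<Rightarrow> real). 0 \<le> t 0 \<longrightarrow> (\<forall>i<n. t i < t (Suc i)) \<longrightarrow>
        prob_space.indep_vars M (\<lambda>_. borel) (\<lambda>i \<omega>. X (t (Suc i)) \<omega> - X (t i) \<omega>) {..<n})"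

definition stationary_increments :: "'w measure \<Rightarrow> (real \<Rightarrow> 'w \<Rightarrow> real ^ 'n) \<Rightarrow> bool" where
  "stationary_increments M X \<longleftrightarrow>
     (\<forall>s\<ge>0. \<forall>t\<ge>0. distr M borel (\<lambda>\<omega>. X (s + t) \<omega> - X s \<omega>) = distr M borel (\<lambda>\<omega>. X t \<omega> - X 0 \<omega>))"

definition stochastically_continuous :: "'w measure \<Rightarrow> (real \<Rightarrow> 'w \<Rightarrow> real ^ 'n) \<Rightarrow> bool" where
  "stochastically_continuous M X \<longleftrightarrow>
     (\<forall>t\<ge>0. \<forall>\<epsilon>>0. ((\<lambda>s. measure M {\<omega> \<in> space M. norm (X s \<omega> - X t \<omega>) > \<epsilon>}) \<longlongrightarrow> 0) (at t within {0..}))"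

text \<open>Only the values at times \<open>t \<ge> 0\<close> matter; no regularity of the paths is required.\<close>

definition levy_process :: "'w measure \<Rightarrow> (real \<Rightarrow> 'w \<Rightarrow> real ^ 'n) \<Rightarrow> bool" where
  "levy_process M X \<longleftrightarrow>
     (\<forall>t\<ge>0. X t \<in> borel_measurable M) \<and>
     (AE \<omega> in M. X 0 \<omega> = 0) \<and>
     stochastically_continuous M X \<and>
     independent_increments M X \<and>
     stationary_increments M X"

text \<open>
  A Levy process with \<open>X\<^sub>1 \<sim> \<mu>\<close>, where \<open>\<mu>\<close> has characteristic function \<open>\<phi> = exp \<circ> \<psi>\<close>.
  The power \<open>\<phi>\<^sup>t\<close> for real \<open>t\<close> is \<open>exp (t \<psi>)\<close>; the principal branch of the logarithm
  would give a wrong value in general.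
\<close>

definition levy_process_with ::
  "'w measure \<Rightarrow> (real \<Rightarrow> 'w \<Rightarrow> real ^ 'n) \<Rightarrow> (real ^ 'n) measure \<Rightarrow> (real ^ 'n \<Rightarrow> complex) \<Rightarrow> bool" where
  "levy_process_with M X \<mu> \<psi> \<longleftrightarrow>
     levy_process M X \<and> distr M borel (X 1) = \<mu> \<and>
     (\<forall>t\<ge>0. \<forall>z. char_fn (distr M borel (X t)) z = exp (complex_of_real t * \<psi> z))"

text \<open>
  Paths are almost surely nondecreasing, so the truncated difference on \<^typ>\<open>nat\<close> used for the
  increments is the true difference up to a null set. Right-continuity is with respect to the
  discrete topology of \<^typ>\<open>nat\<close>.
\<close>

definition poisson_process :: "'w measure \<Rightarrow> real \<Rightarrow> (real \<Rightarrow> 'w \<Rightarrow> nat) \<Rightarrow> bool" where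
  "poisson_process M r N \<longleftrightarrow>
     (\<forall>t\<ge>0. N t \<in> borel_measurable M) \<and>
     (AE \<omega> in M. N 0 \<omega> = 0 \<and> mono_on {0..} (\<lambda>t. N t \<omega>) \<and>
        (\<forall>t\<ge>0. continuous (at_right t) (\<lambda>s. N s \<omega>))) \<and>
     independent_increments M N \<and>
     (\<forall>s t. 0 \<le> s \<and> s < t \<longrightarrow>
        distr M (count_space UNIV) (\<lambda>\<omega>. N t \<omega> - N s \<omega>) = measure_pmf (poisson_pmf (r * (t - s))))"

end

theory Submission
  imports Defs
begin

text \<open>
  Write \<open>\<psi>\<close> and \<open>\<psi>'\<close> for the exponents of \<open>\<mu>\<close> and \<open>\<mu>'\<close>. Splitting the jumps as
  \<open>L = g L + (1 - g) L\<close> leaves a finite measure \<open>\<rho>\<close> in the second part, for which the compensator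
  \<open>\<i> \<langle>z, x\<rangle> h x\<close> can be integrated separately; it is exactly what the shift from \<open>b\<close> to \<open>b'\<close>
  absorbs. Hence \<open>\<psi> z = \<psi>' z + \<integral> (exp (\<i> \<langle>z, x\<rangle>) - 1) \<rho>(dx)\<close>
  (\<open>levy_exponent_thinning\<close>), and the last integral is the exponent of the compound Poisson process
  \<open>V\<close> (\<open>char_fn_jump_sum\<close>). Since \<open>X'\<close> and \<open>V\<close> are independent Levy processes, \<open>X = X' + V\<close> is a
  Levy process (\<open>levy_process_add\<close>) whose characteristic function at time \<open>t\<close> is \<open>exp (t \<psi>)\<close>, and
  \<open>X 1\<close> has law \<open>\<mu>\<close> because characteristic functions determine laws (\<open>char_fn_unique\<close>).

  For the inequality, \<open>X t\<close> and \<open>X' t\<close> agree on the event \<open>V t = 0\<close>, which is independent of \<open>X' t\<close>.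
  Its probability is at least \<open>exp (- t \<eta>)\<close>: if \<open>\<eta> > 0\<close>, it contains the event \<open>N t = 0\<close> of that probability, and otherwise
  \<open>V\<close> vanishes. So \<open>P (X t \<in> B)\<close> is at least \<open>exp (- t \<eta>) P (X' t \<in> B)\<close>.

  Two tools carry the details. Uniqueness of characteristic functions on \<open>real ^ 'n\<close> is reduced to
  the real line by treating one coordinate at a time, with nonnegative trigonometric weights for the
  remaining ones. All independence statements come from freezing (\<open>indep_vars_freezing\<close>): given the
  count process, the increments of \<open>V\<close> are sums of jumps over disjoint blocks of indices, hence
  independent with laws that depend on the count increments only, and the independence of the latter
  carries over. The same principle handles \<open>X' + V\<close>.
\<close>

section \<open>Characteristic functions determine laws on \<open>real ^ 'n\<close>\<close>

lemma integrable_bounded_mult_iexp: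
  fixes W u :: "'a \<Rightarrow> real"
  assumes "finite_measure M" and [measurable]: "W \<in> borel_measurable M" "u \<in> borel_measurable M"
    and "\<And>x. 0 \<le> W x" "\<And>x. W x \<le> C"
  shows "integrable M (\<lambda>x. complex_of_real (W x) * iexp (u x))"
proof -
  interpret finite_measure M by fact
  show ?thesis
    using assms(4,5) by (intro integrable_const_bound[where B=C]) (auto simp: norm_mult)
qed

text \<open>
  Normalizing the weighted measure \<open>W M\<close> to a probability measure and pushing it forward along \<open>u\<close>
  reduces this to the uniqueness theorem on the real line. If the total weight vanishes, both sides
  are \<open>0\<close>.
\<close>

lemma weighted_Levy_uniqueness:
  fixes W u :: "'a \<Rightarrow> real"
  assumes fin: "finite_measure M1" "finite_measure M2" and sets: "sets M1 = sets M2"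
    and W [measurable]: "W \<in> borel_measurable M1" and u [measurable]: "u \<in> borel_measurable M1"
    and W0: "\<And>x. 0 \<le> W x" and WC: "\<And>x. W x \<le> C"
    and eq: "\<And>t. (CLINT x|M1. W x * iexp (t * u x)) = (CLINT x|M2. W x * iexp (t * u x))"
    and B [measurable]: "B \<in> sets borel"
  shows "(LINT x|M1. W x * indicator B (u x)) = (LINT x|M2. W x * indicator B (u x))"
proof -
  interpret M1: finite_measure M1 by fact
  interpret M2: finite_measure M2 by fact
  have W2 [measurable]: "W \<in> borel_measurable M2" and u2 [measurable]: "u \<in> borel_measurable M2"
    using W u sets by (simp_all cong: measurable_cong_sets)
  have int: "integrable M1 W" "integrable M2 W"
    using W0 WC by (auto intro!: M1.integrable_const_bound[where B=C] M2.integrable_const_bound[where B=C])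
  have intB: "integrable M1 (\<lambda>x. W x * indicator B (u x))" "integrable M2 (\<lambda>x. W x * indicator B (u x))"
    using int by (auto intro: Bochner_Integration.integrable_bound simp: indicator_def)
  define c where "c = (LINT x|M1. W x)"
  have c2: "c = (LINT x|M2. W x)"
    using eq[of 0] by (simp add: c_def)
  have c0: "0 \<le> c" by (simp add: c_def W0)
  show ?thesis
  proof (cases "c = 0")
    case True
    have *: "(LINT x|M. W x * indicator B (u x)) = 0"
      if "integrable M (\<lambda>x. W x * indicator B (u x))" "integrable M W" "(LINT x|M. W x) = 0" for M
    proof -
      have "(LINT x|M. W x * indicator B (u x)) \<le> (LINT x|M. W x)"
        using that W0 by (intro integral_mono) (auto simp: indicator_def)
      moreover have "0 \<le> (LINT x|M. W x * indicator B (u x))"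
        using W0 by (intro integral_nonneg_AE) auto
      ultimately show ?thesis using that by simp
    qed
    show ?thesis using *[OF intB(1) int(1)] *[OF intB(2) int(2)] True c_def c2 by simp
  next
    case False
    with c0 have cpos: "c > 0" by simp
    define P where "P M = distr (density M (\<lambda>x. W x / c)) borel u" for M :: "'a measure"
    have P: "real_distribution (P M) \<and> char (P M) = (\<lambda>t. (CLINT x|M. W x * iexp (t * u x)) / c)
        \<and> measure (P M) B = (LINT x|M. W x * indicator B (u x)) / c"
      if [measurable]: "W \<in> borel_measurable M" "u \<in> borel_measurable M"
        and "integrable M W" "(LINT x|M. W x) = c" "integrable M (\<lambda>x. W x * indicator B (u x))" for M
    proof (intro conjI ext)
      have "emeasure (density M (\<lambda>x. W x / c)) (space M) = (\<integral>\<^sup>+x. W x / c \<partial>M)"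
        by (subst emeasure_density) (auto intro!: nn_integral_cong)
      also have "\<dots> = ennreal (LINT x|M. W x / c)"
        using that W0 cpos by (intro nn_integral_eq_integral) auto
      also have "\<dots> = 1" using that cpos by simp
      finally have p: "prob_space (density M (\<lambda>x. W x / c))" by (intro prob_spaceI) simp
      interpret prob_space "density M (\<lambda>x. W x / c)" by fact
      show "real_distribution (P M)"
        unfolding P_def by (intro real_distribution_distr) simp
      show "char (P M) t = (CLINT x|M. W x * iexp (t * u x)) / c" for t
      proof -
        have "char (P M) t = (CLINT x|M. (W x / c) *\<^sub>R iexp (t * u x))"
          using W0 cpos unfolding char_def P_def
          by (subst integral_distr, simp, simp) (subst integral_density, auto)
        also have "\<dots> = (CLINT x|M. (W x * iexp (t * u x)) / c)"
          by (simp add: scaleR_conv_of_real)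
        finally show ?thesis by simp
      qed
      have "measure (P M) B = (LINT x|P M. indicator B x)" by (simp add: P_def)
      also have "\<dots> = (LINT x|M. (W x / c) *\<^sub>R indicator B (u x))"
        using W0 cpos unfolding P_def
        by (subst integral_distr, simp, simp) (subst integral_density, auto)
      also have "\<dots> = (LINT x|M. (W x * indicator B (u x)) / c)" by simp
      finally show "measure (P M) B = (LINT x|M. W x * indicator B (u x)) / c" by simp
    qed
    have P1: "real_distribution (P M1)" "char (P M1) = (\<lambda>t. (CLINT x|M1. W x * iexp (t * u x)) / c)"
        "measure (P M1) B = (LINT x|M1. W x * indicator B (u x)) / c"
      using P[of M1] int intB c_def by simp_all
    have P2: "real_distribution (P M2)" "char (P M2) = (\<lambda>t. (CLINT x|M2. W x * iexp (t * u x)) / c)"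
        "measure (P M2) B = (LINT x|M2. W x * indicator B (u x)) / c"
      using P[of M2] int intB c2 by simp_all
    have "P M1 = P M2"
      using P1 P2 eq by (intro Levy_uniqueness) simp_all
    with P1(3) P2(3) cpos show ?thesis by simp
  qed
qed

text \<open>
  The step that replaces one coordinate of the Fourier kernel by an indicator: the class of weights
  whose Fourier transforms under \<open>M1\<close> and \<open>M2\<close> agree is closed under multiplication by an indicator
  of a coordinate. The weights \<open>W (1 + cos \<langle>z, x\<rangle>)\<close> and \<open>W (1 + sin \<langle>z, x\<rangle>)\<close> are nonnegative, so the
  one-dimensional result applies to them along the coordinate \<open>k\<close>; subtracting the plain weight \<open>W\<close>
  recovers the real and imaginary parts of the kernel.
\<close>

lemma fourier_weight_mult_indicator:
  fixes M1 M2 :: "(real ^ 'n) measure" and W :: "real ^ 'n \<Rightarrow> real"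
  assumes fin: "finite_measure M1" "finite_measure M2"
    and sets [measurable_cong]: "sets M1 = sets borel" "sets M2 = sets borel"
    and W [measurable]: "W \<in> borel_measurable borel"
    and W0: "\<And>x. 0 \<le> W x" and W1: "\<And>x. W x \<le> 1"
    and eq: "\<And>z. (CLINT x|M1. W x * iexp (z \<bullet> x)) = (CLINT x|M2. W x * iexp (z \<bullet> x))"
    and B [measurable]: "B \<in> sets borel"
  shows "(CLINT x|M1. complex_of_real (W x * indicator B (x $ k)) * iexp (z \<bullet> x)) =
         (CLINT x|M2. complex_of_real (W x * indicator B (x $ k)) * iexp (z \<bullet> x))"
proof -
  let ?e = "\<lambda>t::real. axis k t :: real ^ 'n"
  have ax: "?e t \<bullet> x = t * x $ k" for t x by (simp add: inner_axis')
  interpret M1: finite_measure M1 by fact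
  interpret M2: finite_measure M2 by fact
  have ints: "integrable M (\<lambda>x. complex_of_real (W x) * iexp (y \<bullet> x))"
    if "M = M1 \<or> M = M2" for M y
    using that fin W0 W1 by (intro integrable_bounded_mult_iexp[where C=1]) auto
  have step: "(LINT x|M1. V x * indicator B (x $ k)) = (LINT x|M2. V x * indicator B (x $ k))"
    if [measurable]: "V \<in> borel_measurable borel" and "\<And>x. 0 \<le> V x" "\<And>x. V x \<le> 2"
      and "\<And>t. (CLINT x|M1. V x * iexp (t * x $ k)) = (CLINT x|M2. V x * iexp (t * x $ k))" for V :: "real ^ 'n \<Rightarrow> real"
    using that by (intro weighted_Levy_uniqueness[OF fin, where C=2]) (simp_all add: sets)
  have plain: "(LINT x|M1. W x * indicator B (x $ k)) = (LINT x|M2. W x * indicator B (x $ k))"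
  proof (rule step)
    show "W x \<le> 2" for x using W1[of x] by simp
    show "(CLINT x|M1. W x * iexp (t * x $ k)) = (CLINT x|M2. W x * iexp (t * x $ k))" for t
      using eq[of "?e t"] by (simp add: ax)
  qed (use W0 in auto)
  have cosine: "(LINT x|M1. (W x * (1 + cos (z \<bullet> x))) * indicator B (x $ k)) =
      (LINT x|M2. (W x * (1 + cos (z \<bullet> x))) * indicator B (x $ k))"
  proof (rule step)
    have c: "0 \<le> 1 + cos (z \<bullet> x)" "1 + cos (z \<bullet> x) \<le> 2" for x
      using cos_ge_minus_one[of "z \<bullet> x"] cos_le_one[of "z \<bullet> x"] by linarith+
    show "0 \<le> W x * (1 + cos (z \<bullet> x))" for x using W0 c by simp
    show "W x * (1 + cos (z \<bullet> x)) \<le> 2" for x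
      using mult_mono[OF W1 c(2) _ c(1)] by simp
    fix t
    \<comment> \<open>Euler's formula turns the cosine into the two frequencies \<open>z\<close> and \<open>- z\<close>, which shift \<open>?e t\<close>.\<close>
    have "complex_of_real (W x * (1 + cos (z \<bullet> x))) * iexp (t * x $ k) =
        W x * iexp (?e t \<bullet> x) + (W x * iexp ((?e t + z) \<bullet> x) + W x * iexp ((?e t - z) \<bullet> x)) / 2" for x
      by (simp add: inner_diff_left inner_add_left ax exp_add exp_diff algebra_simps cos_of_real[symmetric]
         cos_exp_eq exp_minus del: cos_of_real)
         (simp add: field_simps)
    then have "(CLINT x|M. complex_of_real (W x * (1 + cos (z \<bullet> x))) * iexp (t * x $ k)) =
        (CLINT x|M. W x * iexp (?e t \<bullet> x)) +
        ((CLINT x|M. W x * iexp ((?e t + z) \<bullet> x)) + (CLINT x|M. W x * iexp ((?e t - z) \<bullet> x))) / 2"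
      if "M = M1 \<or> M = M2" for M
      using ints[OF that] by (simp add: Bochner_Integration.integral_add del: of_real_mult of_real_add of_real_diff)
    then show "(CLINT x|M1. complex_of_real (W x * (1 + cos (z \<bullet> x))) * iexp (t * x $ k)) =
        (CLINT x|M2. complex_of_real (W x * (1 + cos (z \<bullet> x))) * iexp (t * x $ k))"
      using eq by simp
  qed simp
  have sine: "(LINT x|M1. (W x * (1 + sin (z \<bullet> x))) * indicator B (x $ k)) =
      (LINT x|M2. (W x * (1 + sin (z \<bullet> x))) * indicator B (x $ k))"
  proof (rule step)
    have c: "0 \<le> 1 + sin (z \<bullet> x)" "1 + sin (z \<bullet> x) \<le> 2" for x
      using sin_ge_minus_one[of "z \<bullet> x"] sin_le_one[of "z \<bullet> x"] by linarith+
    show "0 \<le> W x * (1 + sin (z \<bullet> x))" for x using W0 c by simp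
    show "W x * (1 + sin (z \<bullet> x)) \<le> 2" for x
      using mult_mono[OF W1 c(2) _ c(1)] by simp
    fix t
    have "complex_of_real (W x * (1 + sin (z \<bullet> x))) * iexp (t * x $ k) =
        W x * iexp (?e t \<bullet> x) + (W x * iexp ((?e t + z) \<bullet> x) - W x * iexp ((?e t - z) \<bullet> x)) / (2 * \<i>)" for x
      by (simp add: inner_diff_left inner_add_left ax exp_add exp_diff algebra_simps sin_of_real[symmetric]
         sin_exp_eq exp_minus del: sin_of_real)
         (simp add: field_simps)
    then have "(CLINT x|M. complex_of_real (W x * (1 + sin (z \<bullet> x))) * iexp (t * x $ k)) =
        (CLINT x|M. W x * iexp (?e t \<bullet> x)) +
        ((CLINT x|M. W x * iexp ((?e t + z) \<bullet> x)) - (CLINT x|M. W x * iexp ((?e t - z) \<bullet> x))) / (2 * \<i>)"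
      if "M = M1 \<or> M = M2" for M
      using ints[OF that] by (simp add: Bochner_Integration.integral_add Bochner_Integration.integral_diff del: of_real_mult of_real_add of_real_diff)
    then show "(CLINT x|M1. complex_of_real (W x * (1 + sin (z \<bullet> x))) * iexp (t * x $ k)) =
        (CLINT x|M2. complex_of_real (W x * (1 + sin (z \<bullet> x))) * iexp (t * x $ k))"
      using eq by simp
  qed simp
  have bdd: "integrable M (\<lambda>x. W x * indicator B (x $ k) * f x)"
    if "M = M1 \<or> M = M2" and [measurable]: "f \<in> borel_measurable borel" and f: "\<And>x. \<bar>f x\<bar> \<le> 1"
    for M and f :: "real ^ 'n \<Rightarrow> real"
  proof -
    have [measurable_cong]: "sets M = sets borel" and "finite_measure M" using that fin sets by auto
    then interpret finite_measure M by simp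
    have "\<bar>W x * indicator B (x $ k) * f x\<bar> \<le> 1" for x
      using W0[of x] W1[of x] f[of x] by (auto simp: indicator_def abs_mult intro: mult_le_one)
    then show ?thesis by (intro integrable_const_bound[where B=1]) auto
  qed
  have expand: "(CLINT x|M. complex_of_real (W x * indicator B (x $ k)) * iexp (z \<bullet> x)) =
      complex_of_real ((LINT x|M. (W x * (1 + cos (z \<bullet> x))) * indicator B (x $ k)) - (LINT x|M. W x * indicator B (x $ k)))
      + \<i> * complex_of_real ((LINT x|M. (W x * (1 + sin (z \<bullet> x))) * indicator B (x $ k)) - (LINT x|M. W x * indicator B (x $ k)))"
    if M: "M = M1 \<or> M = M2" for M
  proof -
    have i: "integrable M (\<lambda>x. W x * indicator B (x $ k))"
        "integrable M (\<lambda>x. W x * indicator B (x $ k) * cos (z \<bullet> x))"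
        "integrable M (\<lambda>x. W x * indicator B (x $ k) * sin (z \<bullet> x))"
      using bdd[OF M, of "\<lambda>_. 1"] bdd[OF M, of "\<lambda>x. cos (z \<bullet> x)"] bdd[OF M, of "\<lambda>x. sin (z \<bullet> x)"] by simp_all
    have 1: "(LINT x|M. (W x * (1 + cos (z \<bullet> x))) * indicator B (x $ k)) - (LINT x|M. W x * indicator B (x $ k))
        = (LINT x|M. W x * indicator B (x $ k) * cos (z \<bullet> x))"
      and 2: "(LINT x|M. (W x * (1 + sin (z \<bullet> x))) * indicator B (x $ k)) - (LINT x|M. W x * indicator B (x $ k))
        = (LINT x|M. W x * indicator B (x $ k) * sin (z \<bullet> x))"
      using i by (simp_all add: algebra_simps Bochner_Integration.integral_add)
    have "(CLINT x|M. complex_of_real (W x * indicator B (x $ k)) * iexp (z \<bullet> x)) =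
       (CLINT x|M. complex_of_real (W x * indicator B (x $ k) * cos (z \<bullet> x)) + \<i> * complex_of_real (W x * indicator B (x $ k) * sin (z \<bullet> x)))"
      by (intro Bochner_Integration.integral_cong) (simp_all add: exp_Euler cos_of_real sin_of_real algebra_simps)
    also have "\<dots> = complex_of_real (LINT x|M. W x * indicator B (x $ k) * cos (z \<bullet> x)) + \<i> * complex_of_real (LINT x|M. W x * indicator B (x $ k) * sin (z \<bullet> x))"
      using i(2,3) by (simp del: of_real_mult add: Bochner_Integration.integral_add)
    finally show ?thesis unfolding 1 2 .
  qed
  show ?thesis using expand[of M1] expand[of M2] plain cosine sine by simp
qed

text \<open>
  By induction on a set of coordinates, both measures give the same Fourier transform after weighting
  with the indicator of a box in these coordinates. Once all coordinates are used, the frequency \<open>0\<close>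
  compares the measures of boxes, which generate the Borel sets.
\<close>

lemma char_fn_unique:
  fixes M1 M2 :: "(real ^ 'n) measure"
  assumes fin: "finite_measure M1" "finite_measure M2"
    and sets [measurable_cong]: "sets M1 = sets borel" "sets M2 = sets borel"
    and eq: "\<And>z. char_fn M1 z = char_fn M2 z"
  shows "M1 = M2"
proof -
  interpret M1: finite_measure M1 by fact
  interpret M2: finite_measure M2 by fact
  let ?W = "\<lambda>a b J x. \<Prod>k\<in>J. indicator {a $ k <..< b $ k} (x $ k) :: real"
  have W: "0 \<le> ?W a b J x" "?W a b J x \<le> 1" for a b :: "real ^ 'n" and J x
    by (auto intro!: prod_nonneg prod_le_1)
  have rect: "(CLINT x|M1. complex_of_real (?W a b J x) * iexp (z \<bullet> x)) =
      (CLINT x|M2. complex_of_real (?W a b J x) * iexp (z \<bullet> x))" for a b z J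
  proof (induction J arbitrary: z rule: finite_induct[OF finite])
    case 1
    then show ?case using eq[of z] by (simp add: char_fn_def)
  next
    case (2 k F)
    show ?case
      using fourier_weight_mult_indicator[OF fin sets, where W="?W a b F" and B="{a $ k <..< b $ k}" and k=k and z=z] 2 W
      by (simp add: mult_ac)
  qed
  have box: "emeasure M1 (box a b) = emeasure M2 (box a b)" for a b
  proof -
    have I: "?W a b UNIV x = indicator (box a b) x" for x
      by (auto simp: indicator_def mem_box_cart prod_zero_iff)
    have "measure M1 (box a b) = measure M2 (box a b)"
      using rect[of a b UNIV 0] sets by (simp add: I sets_eq_imp_space_eq)
    then show ?thesis by (simp add: M1.emeasure_eq_measure M2.emeasure_eq_measure)
  qed
  let ?E = "range (\<lambda>(a, b). box a b :: (real ^ 'n) set)"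
  show ?thesis
  proof (rule measure_eqI_generator_eq[where E="?E" and \<Omega>=UNIV and A="\<lambda>n::nat. box (- real n *\<^sub>R One) (real n *\<^sub>R One)"])
    show "Int_stable ?E"
      by (auto simp: Int_stable_def box_Int_box)
    show "sets M1 = sigma_sets UNIV ?E" "sets M2 = sigma_sets UNIV ?E"
      using sets by (simp_all add: borel_eq_box)
    show "(\<Union>i::nat. box (- real i *\<^sub>R One) (real i *\<^sub>R One)) = (UNIV :: (real ^ 'n) set)"
      using UN_box_eq_UNIV by simp
  qed (use box in auto)
qed

section \<open>Freezing one of two independent sigma-algebras\<close>

text \<open>
  Independence of \<open>F\<close> and \<open>G\<close> says that the diagonal map pushes \<open>M\<close> forward to the product of its
  restrictions to \<open>F\<close> and \<open>G\<close>; the formula is Fubini's theorem for this product. Conditional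
  expectations are thus replaced by an integral with one argument held fixed.
\<close>

lemma (in prob_space) freezing:
  fixes f :: "'a \<Rightarrow> 'a \<Rightarrow> 'b::{banach, second_countable_topology}"
  assumes space: "space F = space M" "space G = space M" and indep: "indep_set (sets F) (sets G)"
    and f [measurable]: "(\<lambda>(x, y). f x y) \<in> borel_measurable (F \<Otimes>\<^sub>M G)"
    and bound: "\<And>x y. x \<in> space M \<Longrightarrow> y \<in> space M \<Longrightarrow> norm (f x y) \<le> C"
  shows "(\<lambda>\<omega>. f \<omega> \<omega>) \<in> borel_measurable M" (is ?meas)
    and "(\<lambda>y. \<integral>x. f x y \<partial>M) \<in> borel_measurable G" (is ?meas_inner)
    and "(\<integral>\<omega>. f \<omega> \<omega> \<partial>M) = (\<integral>y. (\<integral>x. f x y \<partial>M) \<partial>M)" (is ?eq)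
proof -
  have sub: "sets F \<subseteq> events" "sets G \<subseteq> events"
    using indep_setD_ev1[OF indep] indep_setD_ev2[OF indep] .
  have idF [measurable]: "(\<lambda>x. x) \<in> measurable M F" and idG [measurable]: "(\<lambda>x. x) \<in> measurable M G"
    using sub space by (auto simp: measurable_def intro: sets.Int_space_eq2 sets.Int)
  \<comment> \<open>The identity generates exactly the sigma-algebra of its target, so it represents \<open>H\<close> as a random variable.\<close>
  have gen: "sigma_sets (space M) {(\<lambda>x. x) -` A \<inter> space M |A. A \<in> sets H} = sets H"
    if "space H = space M" for H :: "'a measure"
  proof -
    have "{(\<lambda>x. x) -` A \<inter> space M |A. A \<in> sets H} = sets H"
      using sets.sets_into_space[of _ H] that by (auto simp: Int_absorb2)
    then show ?thesis using sets.sigma_sets_eq[of H] that by simp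
  qed
  have iv: "indep_var F (\<lambda>x. x) G (\<lambda>x. x)"
    using indep idF idG unfolding indep_var_eq gen[OF space(1)] gen[OF space(2)] by simp
  let ?F = "distr M F (\<lambda>x. x)" and ?G = "distr M G (\<lambda>x. x)"
  interpret F: prob_space ?F by (rule prob_space_distr) simp
  interpret G: prob_space ?G by (rule prob_space_distr) simp
  interpret FG: pair_prob_space ?F ?G ..
  have joint: "?F \<Otimes>\<^sub>M ?G = distr M (F \<Otimes>\<^sub>M G) (\<lambda>x. (x, x))"
    using iv unfolding indep_var_distribution_eq by simp
  show ?meas
    using measurable_compose[of "\<lambda>x. (x, x)" M "F \<Otimes>\<^sub>M G" "\<lambda>(x, y). f x y" borel] by simp
  have m1: "(\<lambda>x. f x y) \<in> borel_measurable F" if "y \<in> space M" for y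
    using measurable_Pair1[OF f, of y] that space by simp
  have inner: "(\<integral>x. f x y \<partial>?F) = (\<integral>x. f x y \<partial>M)" if "y \<in> space M" for y
    using m1[OF that] by (subst integral_distr) auto
  have "(\<lambda>y. \<integral>x. (\<lambda>(y, x). f x y) (y, x) \<partial>?F) \<in> borel_measurable ?G"
    by (rule F.borel_measurable_lebesgue_integral) simp
  then have "(\<lambda>y. \<integral>x. f x y \<partial>?F) \<in> borel_measurable G" by simp
  moreover have "(\<lambda>y. \<integral>x. f x y \<partial>?F) \<in> borel_measurable G \<longleftrightarrow> ?meas_inner"
    by (rule measurable_cong, rule inner) (simp add: space(2))
  ultimately show mi: ?meas_inner by simp
  have int: "integrable (?F \<Otimes>\<^sub>M ?G) (\<lambda>(x, y). f x y)"
    using bound space by (intro FG.integrable_const_bound[where B=C] AE_I2) (auto simp: space_pair_measure)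
  have "(\<integral>\<omega>. f \<omega> \<omega> \<partial>M) = (\<integral>(x, y). f x y \<partial>(?F \<Otimes>\<^sub>M ?G))"
    unfolding joint by (subst integral_distr) auto
  also have "\<dots> = (\<integral>y. (\<integral>x. f x y \<partial>?F) \<partial>?G)"
    using FG.integral_snd[of f] int by simp
  also have "\<dots> = (\<integral>y. (\<integral>x. f x y \<partial>M) \<partial>?G)"
    by (rule Bochner_Integration.integral_cong[OF refl], rule inner) (simp add: space(2))
  also have "\<dots> = (\<integral>y. (\<integral>x. f x y \<partial>M) \<partial>M)"
    using mi by (subst integral_distr) auto
  finally show ?eq .
qed

lemma (in prob_space) indep_vars_cong_space:
  assumes "indep_vars M' X I" and eq: "\<And>i \<omega>. i \<in> I \<Longrightarrow> \<omega> \<in> space M \<Longrightarrow> X i \<omega> = Y i \<omega>"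
  shows "indep_vars M' Y I"
proof -
  have "{X i -` A \<inter> space M |A. A \<in> sets (M' i)} = {Y i -` A \<inter> space M |A. A \<in> sets (M' i)}" if "i \<in> I" for i
  proof -
    have "X i -` A \<inter> space M = Y i -` A \<inter> space M" for A using eq[OF that] by auto
    then show ?thesis by simp
  qed
  moreover have "random_variable (M' i) (X i) = random_variable (M' i) (Y i)" if "i \<in> I" for i
    using eq[OF that] by (rule measurable_cong)
  ultimately show ?thesis
    using assms(1) unfolding indep_vars_def2 by (simp cong: indep_sets_cong)
qed

lemma (in prob_space) indep_vars_borelI:
  assumes I: "finite I"
    and rv: "\<And>i. i \<in> I \<Longrightarrow> random_variable borel (X i)"
    and prod: "\<And>B. (\<And>i. i \<in> I \<Longrightarrow> B i \<in> sets borel) \<Longrightarrow>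
      expectation (\<lambda>\<omega>. \<Prod>i\<in>I. indicator (B i) (X i \<omega>) :: real) = (\<Prod>i\<in>I. expectation (\<lambda>\<omega>. indicator (B i) (X i \<omega>)))"
  shows "indep_vars (\<lambda>_. borel) X I"
proof (cases "I = {}")
  case True
  then show ?thesis by (auto simp: indep_vars_def2 indep_sets_def)
next
  case False
  have "prob (\<Inter>i\<in>I. X i -` B i \<inter> space M) = (\<Prod>i\<in>I. prob (X i -` B i \<inter> space M))"
    if B: "\<And>i. i \<in> I \<Longrightarrow> B i \<in> sets borel" for B
  proof -
    have ind: "indicator (X i -` B i \<inter> space M) \<omega> = (indicator (B i) (X i \<omega>) :: real)" if "\<omega> \<in> space M" for i \<omega>
      using that by (auto simp: indicator_def)
    have "prob (X i -` B i \<inter> space M) = expectation (\<lambda>\<omega>. indicator (B i) (X i \<omega>))" if "i \<in> I" for i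
    proof -
      have "prob (X i -` B i \<inter> space M) = expectation (indicator (X i -` B i \<inter> space M))"
        by (simp add: Int_absorb2)
      then show ?thesis by (simp add: ind cong: Bochner_Integration.integral_cong)
    qed
    moreover have "prob (\<Inter>i\<in>I. X i -` B i \<inter> space M) = expectation (\<lambda>\<omega>. \<Prod>i\<in>I. indicator (B i) (X i \<omega>))"
    proof -
      have "prob (\<Inter>i\<in>I. X i -` B i \<inter> space M) = expectation (indicator (\<Inter>i\<in>I. X i -` B i \<inter> space M))"
        using False by (subst Bochner_Integration.integral_indicator) (auto intro!: arg_cong[where f=prob])
      also have "\<dots> = expectation (\<lambda>\<omega>. \<Prod>i\<in>I. indicator (B i) (X i \<omega>))"
        using I by (intro Bochner_Integration.integral_cong) (auto simp: indicator_def prod_zero_iff)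
      finally show ?thesis .
    qed
    ultimately show ?thesis using prod[OF B] by simp
  qed
  then show ?thesis
    using I False rv
    by (subst indep_vars_finite[where E="\<lambda>_. sets borel"])
       (auto simp: Int_stable_def sets.sigma_sets_eq[of borel, simplified])
qed

text \<open>
  Conditional independence becomes independence when the conditional laws depend on independent
  quantities. Freezing \<open>y\<close>, the expectation of a product of indicators factors into
  \<open>\<Prod>i\<in>I. q i (B i) (K i y)\<close>; integrating over \<open>y\<close> factors once more because the \<open>K i\<close> are
  independent.
\<close>

lemma (in prob_space) indep_vars_freezing:
  fixes W :: "'i \<Rightarrow> 'a \<Rightarrow> 'a \<Rightarrow> 'b::topological_space"
  assumes I: "finite I"
    and space: "space F = space M" "space G = space M" and indep: "indep_set (sets F) (sets G)"
    and W: "\<And>i. i \<in> I \<Longrightarrow> (\<lambda>(x, y). W i x y) \<in> borel_measurable (F \<Otimes>\<^sub>M G)"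
    and inner: "AE y in M. indep_vars (\<lambda>_. borel) (\<lambda>i x. W i x y) I"
    and K: "indep_vars S K I"
    and q: "\<And>i B. i \<in> I \<Longrightarrow> B \<in> sets borel \<Longrightarrow> q i B \<in> borel_measurable (S i)"
    and law: "\<And>i B. i \<in> I \<Longrightarrow> B \<in> sets borel \<Longrightarrow>
      AE y in M. expectation (\<lambda>x. indicator B (W i x y) :: real) = q i B (K i y)"
  shows "indep_vars (\<lambda>_. borel) (\<lambda>i \<omega>. W i \<omega> \<omega>) I"
proof (rule indep_vars_borelI[OF I])
  have idF: "(\<lambda>x. x) \<in> measurable M F" and idG: "(\<lambda>x. x) \<in> measurable M G"
    using indep_setD_ev1[OF indep] indep_setD_ev2[OF indep] space
    by (auto simp: measurable_def intro: sets.Int_space_eq2 sets.Int)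
  show "random_variable borel (\<lambda>\<omega>. W i \<omega> \<omega>)" if "i \<in> I" for i
    using measurable_compose[OF _ W[OF that], of "\<lambda>x. (x, x)" M] idF idG by simp
  have rvK: "random_variable (S i) (K i)" if "i \<in> I" for i
    using K that by (simp add: indep_vars_def)
  fix B :: "'i \<Rightarrow> 'b set" assume B: "\<And>i. i \<in> I \<Longrightarrow> B i \<in> sets borel"
  have nb1: "norm (indicat_real A x) \<le> 1" for A and x :: 'b
    by (simp add: indicator_def)
  have W1: "(\<lambda>(x, y). indicat_real (B i) (W i x y)) \<in> borel_measurable (F \<Otimes>\<^sub>M G)" if "i \<in> I" for i
    using measurable_compose[OF W[OF that], of "indicator (B i)" borel] B[OF that]
    by (simp add: split_beta')
  have W2: "(\<lambda>(x, y). \<Prod>i\<in>I. indicat_real (B i) (W i x y)) \<in> borel_measurable (F \<Otimes>\<^sub>M G)"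
    using W1 by (auto simp: split_beta' intro!: borel_measurable_prod)
  have rvx: "random_variable borel (\<lambda>x. W i x y)" if "i \<in> I" "y \<in> space M" for i y
  proof -
    have "(\<lambda>x. W i x y) \<in> borel_measurable F"
      using measurable_Pair1[OF W[OF that(1)], of y] that(2) space by simp
    then show ?thesis by (rule measurable_compose[OF idF])
  qed
  have Wint: "integrable M (\<lambda>x. indicat_real (B i) (W i x y))" if "i \<in> I" "y \<in> space M" for i y
    using measurable_compose[OF rvx[OF that] borel_measurable_indicator[OF B[OF that(1)]]] nb1
    by (intro integrable_const_bound[where B=1] AE_I2)
  have single: "expectation (\<lambda>\<omega>. indicat_real (B i) (W i \<omega> \<omega>)) = expectation (\<lambda>y. q i (B i) (K i y))" if "i \<in> I" for i
  proof -
    have "expectation (\<lambda>\<omega>. indicat_real (B i) (W i \<omega> \<omega>)) =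
        expectation (\<lambda>y. expectation (\<lambda>x. indicat_real (B i) (W i x y)))"
      by (rule freezing(3)[OF space indep W1[OF that], where C=1]) (rule nb1)
    also have "\<dots> = expectation (\<lambda>y. q i (B i) (K i y))"
    proof (rule integral_cong_AE)
      show "(\<lambda>y. expectation (\<lambda>x. indicat_real (B i) (W i x y))) \<in> borel_measurable M"
        by (rule measurable_compose[OF idG freezing(2)[OF space indep W1[OF that], where C=1]])
          (rule nb1)
      show "(\<lambda>y. q i (B i) (K i y)) \<in> borel_measurable M"
        by (rule measurable_compose[OF rvK[OF that] q[OF that B[OF that]]])
    qed (rule law[OF that B[OF that]])
    finally show ?thesis .
  qed
  have qm: "(\<lambda>y. q i (B i) (K i y)) \<in> borel_measurable M" if "i \<in> I" for i
    by (rule measurable_compose[OF rvK[OF that] q[OF that B[OF that]]])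
  have indq: "indep_vars (\<lambda>_. borel) (\<lambda>i y. q i (B i) (K i y)) I"
    by (rule indep_vars_compose2[OF K, where Y="\<lambda>i. q i (B i)"]) (intro q B)
  have bound: "AE y in M. norm (q i (B i) (K i y)) \<le> 1" if "i \<in> I" for i
    using law[OF that B[OF that]] AE_space
  proof eventually_elim
    case (elim y)
    have "norm (expectation (\<lambda>x. indicat_real (B i) (W i x y))) \<le> expectation (\<lambda>x. 1)"
      using Wint[OF that elim(2)] nb1
      by (intro order_trans[OF integral_norm_bound] integral_mono) simp_all
    then show ?case using elim by (simp add: prob_space)
  qed
  have intq: "integrable M (\<lambda>y. q i (B i) (K i y))" if "i \<in> I" for i
    by (rule integrable_const_bound[OF bound[OF that] qm[OF that]])
  have "AE y in M. \<forall>i\<in>I. expectation (\<lambda>x. indicat_real (B i) (W i x y)) = q i (B i) (K i y)"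
    by (rule AE_finite_allI[OF I]) (rule law[OF _ B])
  then have innerprod: "AE y in M. expectation (\<lambda>x. \<Prod>i\<in>I. indicat_real (B i) (W i x y)) = (\<Prod>i\<in>I. q i (B i) (K i y))"
    using inner
  proof eventually_elim
    case (elim y)
    have iv: "indep_vars (\<lambda>_. borel) (\<lambda>i x. indicat_real (B i) (W i x y)) I"
      using B by (intro indep_vars_compose2[OF elim(2)] borel_measurable_indicator)
    moreover have "integrable M (\<lambda>x. indicat_real (B i) (W i x y))" if "i \<in> I" for i
      using iv that nb1 by (intro integrable_const_bound[where B=1] AE_I2) (simp_all add: indep_vars_def)
    ultimately have "expectation (\<lambda>x. \<Prod>i\<in>I. indicat_real (B i) (W i x y)) =
        (\<Prod>i\<in>I. expectation (\<lambda>x. indicat_real (B i) (W i x y)))"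
      using I by (intro indep_vars_lebesgue_integral) auto
    also have "\<dots> = (\<Prod>i\<in>I. q i (B i) (K i y))" using elim(1) by (intro prod.cong) auto
    finally show ?case .
  qed
  have nb: "norm (\<Prod>i\<in>I. indicat_real (B i) (W i x y)) \<le> 1" for x y
    unfolding prod_norm[symmetric] by (intro prod_le_1) (auto simp: indicator_def)
  have "expectation (\<lambda>\<omega>. \<Prod>i\<in>I. indicat_real (B i) (W i \<omega> \<omega>)) =
      expectation (\<lambda>y. expectation (\<lambda>x. \<Prod>i\<in>I. indicat_real (B i) (W i x y)))"
    by (rule freezing(3)[OF space indep W2, where C=1]) (rule nb)
  also have "\<dots> = expectation (\<lambda>y. \<Prod>i\<in>I. q i (B i) (K i y))"
  proof (rule integral_cong_AE[OF _ _ innerprod])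
    show "(\<lambda>y. expectation (\<lambda>x. \<Prod>i\<in>I. indicat_real (B i) (W i x y))) \<in> borel_measurable M"
      by (rule measurable_compose[OF idG freezing(2)[OF space indep W2, where C=1]]) (rule nb)
    show "(\<lambda>y. \<Prod>i\<in>I. q i (B i) (K i y)) \<in> borel_measurable M"
      using intq by (intro borel_measurable_prod) auto
  qed
  also have "\<dots> = (\<Prod>i\<in>I. expectation (\<lambda>y. q i (B i) (K i y)))"
    using I indq intq by (intro indep_vars_lebesgue_integral) auto
  also have "\<dots> = (\<Prod>i\<in>I. expectation (\<lambda>\<omega>. indicat_real (B i) (W i \<omega> \<omega>)))"
    using single by simp
  finally show "expectation (\<lambda>\<omega>. \<Prod>i\<in>I. indicat_real (B i) (W i \<omega> \<omega>)) =
    (\<Prod>i\<in>I. expectation (\<lambda>\<omega>. indicat_real (B i) (W i \<omega> \<omega>)))" .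
qed

text \<open>
  Freezing \<open>Y\<close> leaves translates of the independent variables \<open>X i\<close>, and the law of the \<open>i\<close>-th
  translate depends on \<open>Y i\<close> alone.
\<close>

lemma (in prob_space) indep_vars_add_indep_families:
  fixes X Y :: "'i \<Rightarrow> 'a \<Rightarrow> 'b::{second_countable_topology, topological_monoid_add}"
  assumes I: "finite I"
    and space: "space F = space M" "space G = space M" and indep: "indep_set (sets F) (sets G)"
    and X: "\<And>i. i \<in> I \<Longrightarrow> X i \<in> borel_measurable F" and Y: "\<And>i. i \<in> I \<Longrightarrow> Y i \<in> borel_measurable G"
    and iX: "indep_vars (\<lambda>_. borel) X I" and iY: "indep_vars (\<lambda>_. borel) Y I"
  shows "indep_vars (\<lambda>_. borel) (\<lambda>i \<omega>. X i \<omega> + Y i \<omega>) I"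
proof (rule indep_vars_freezing[OF I space indep, where W="\<lambda>i x y. X i x + Y i y" and S="\<lambda>_. borel" and K=Y
      and q="\<lambda>i B c. expectation (\<lambda>x. indicator B (X i x + c) :: real)"])
  show "(\<lambda>(x, y). X i x + Y i y) \<in> borel_measurable (F \<Otimes>\<^sub>M G)" if "i \<in> I" for i
  proof -
    note X[OF that, measurable] Y[OF that, measurable]
    show ?thesis by measurable
  qed
  show "AE y in M. indep_vars (\<lambda>_. borel) (\<lambda>i x. X i x + Y i y) I"
    by (intro AE_I2 indep_vars_compose2[OF iX]) simp_all
  show "(\<lambda>c. expectation (\<lambda>x. indicator B (X i x + c) :: real)) \<in> borel_measurable borel"
    if [simp]: "i \<in> I" and [measurable]: "B \<in> sets borel" for i B
  proof -
    have "X i \<in> borel_measurable M" using iX by (simp add: indep_vars_def)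
    then have "(\<lambda>(c, x). indicator B (X i x + c) :: real) \<in> borel_measurable (borel \<Otimes>\<^sub>M M)"
      by simp
    then show ?thesis by (rule borel_measurable_lebesgue_integral)
  qed
  show "AE y in M. expectation (\<lambda>x. indicator B (X i x + Y i y) :: real) =
      expectation (\<lambda>x. indicator B (X i x + Y i y))" for i B
    by (rule AE_I2) (rule refl)
qed (fact iY)

section \<open>Sigma-algebras generated by processes\<close>

text \<open>
  The events of a process as a measurable space, so that measurability of compound expressions with
  respect to them can be derived compositionally.
\<close>

definition process_algebra :: "'w measure \<Rightarrow> 'i set \<Rightarrow> ('i \<Rightarrow> 'w \<Rightarrow> 'b::topological_space) \<Rightarrow> 'w measure" where
  "process_algebra M I Y = sigma (space M) (process_events M I Y)"

lemma space_process_algebra [simp]: "space (process_algebra M I Y) = space M"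
  by (simp add: process_algebra_def space_measure_of_conv)

lemma sets_process_algebra [simp]: "sets (process_algebra M I Y) = process_events M I Y"
proof -
  have *: "(\<Union>i\<in>I. {Y i -` B \<inter> space M |B. B \<in> sets borel}) \<subseteq> Pow (space M)" by auto
  then have "process_events M I Y \<subseteq> Pow (space M)"
    unfolding process_events_def using sigma_sets_into_sp[OF *] by auto
  then show ?thesis
    using * by (simp add: process_algebra_def process_events_def sigma_sets_sigma_sets_eq)
qed

lemma measurable_process_algebra:
  fixes Y :: "'i \<Rightarrow> 'w \<Rightarrow> 'b::topological_space"
  assumes "i \<in> I" shows "Y i \<in> borel_measurable (process_algebra M I Y)"
proof (rule measurableI)
  fix B :: "'b set" assume "B \<in> sets borel"
  with assms show "Y i -` B \<inter> space (process_algebra M I Y) \<in> sets (process_algebra M I Y)"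
    by (auto simp: process_events_def intro!: sigma_sets.Basic)
qed simp

lemma (in prob_space) indep_set_commute: "indep_set A B \<Longrightarrow> indep_set B A"
  unfolding indep_sets2_eq by (metis Int_commute mult.commute)

section \<open>Characteristic functions of independent and of random sums\<close>

lemma char_fn_distr:
  assumes [measurable]: "X \<in> borel_measurable M"
  shows "char_fn (distr M borel X) z = (CLINT \<omega>|M. iexp (z \<bullet> X \<omega>))"
  unfolding char_fn_def by (subst integral_distr) auto

lemma (in prob_space) integrable_iexp_inner:
  fixes X :: "'a \<Rightarrow> real ^ 'n"
  assumes [measurable]: "X \<in> borel_measurable M"
  shows "integrable M (\<lambda>\<omega>. iexp (z \<bullet> X \<omega>))"
  by (rule integrable_iexp) auto

lemma (in prob_space) char_fn_add:
  assumes indep: "indep_set (sets F) (sets G)" and space: "space F = space M" "space G = space M"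
    and X: "X \<in> borel_measurable F" and Y: "Y \<in> borel_measurable G"
  shows "char_fn (distr M borel (\<lambda>\<omega>. X \<omega> + Y \<omega>)) z = char_fn (distr M borel X) z * char_fn (distr M borel Y) z"
proof -
  have sub: "sets F \<subseteq> events" "sets G \<subseteq> events"
    using indep_setD_ev1[OF indep] indep_setD_ev2[OF indep] .
  have id: "(\<lambda>x. x) \<in> measurable M F" "(\<lambda>x. x) \<in> measurable M G"
    using sub space by (auto simp: measurable_def intro: sets.Int_space_eq2 sets.Int)
  have XM: "X \<in> borel_measurable M" and YM: "Y \<in> borel_measurable M"
    using measurable_compose[OF id(1) X] measurable_compose[OF id(2) Y] .
  have "char_fn (distr M borel (\<lambda>\<omega>. X \<omega> + Y \<omega>)) z = (CLINT \<omega>|M. iexp (z \<bullet> X \<omega>) * iexp (z \<bullet> Y \<omega>))"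
    using XM YM by (subst char_fn_distr) (simp_all add: inner_add_right exp_add algebra_simps)
  also have "\<dots> = (CLINT y|M. CLINT x|M. iexp (z \<bullet> X x) * iexp (z \<bullet> Y y))"
  proof (rule freezing(3)[OF space indep, where C=1])
    note X [measurable] Y [measurable]
    show "(\<lambda>(x, y). iexp (z \<bullet> X x) * iexp (z \<bullet> Y y)) \<in> borel_measurable (F \<Otimes>\<^sub>M G)" by measurable
  qed (simp add: norm_mult)
  also have "\<dots> = char_fn (distr M borel X) z * char_fn (distr M borel Y) z"
    using XM YM by (simp add: char_fn_distr)
  finally show ?thesis .
qed

lemma (in prob_space) char_fn_sum_iid:
  assumes J: "finite J" and Z: "indep_vars (\<lambda>_. borel) Z J" and \<nu>: "\<And>j. j \<in> J \<Longrightarrow> distr M borel (Z j) = \<nu>"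
  shows "char_fn (distr M borel (\<lambda>\<omega>. \<Sum>j\<in>J. Z j \<omega>)) z = char_fn \<nu> z ^ card J"
proof -
  have rv: "Z j \<in> borel_measurable M" if "j \<in> J" for j
    using Z that by (simp add: indep_vars_def)
  have "char_fn (distr M borel (\<lambda>\<omega>. \<Sum>j\<in>J. Z j \<omega>)) z = (CLINT \<omega>|M. iexp (z \<bullet> (\<Sum>j\<in>J. Z j \<omega>)))"
    by (rule char_fn_distr) (intro borel_measurable_sum rv)
  also have "\<dots> = (CLINT \<omega>|M. (\<Prod>j\<in>J. iexp (z \<bullet> Z j \<omega>)))"
    using J by (simp add: inner_sum_right sum_distrib_left exp_sum)
  also have "\<dots> = (\<Prod>j\<in>J. (CLINT \<omega>|M. iexp (z \<bullet> Z j \<omega>)))"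
  proof (rule indep_vars_lebesgue_integral[OF J])
    show "indep_vars (\<lambda>_. borel) (\<lambda>j \<omega>. iexp (z \<bullet> Z j \<omega>)) J"
      by (rule indep_vars_compose2[OF Z, where Y="\<lambda>_ x. iexp (z \<bullet> x)"]) simp
  qed (rule integrable_iexp_inner[OF rv])
  also have "\<dots> = (\<Prod>j\<in>J. char_fn \<nu> z)"
    using rv \<nu> by (intro prod.cong) (auto simp: char_fn_distr[symmetric])
  finally show ?thesis by simp
qed

text \<open>
  The law of a block of iid summands depends only on its length, since the characteristic function is
  a power with that exponent.
\<close>

lemma (in prob_space) distr_sum_iid_cong:
  fixes Z :: "'i \<Rightarrow> 'a \<Rightarrow> real ^ 'n"
  assumes Z: "indep_vars (\<lambda>_. borel) Z I" and \<nu>: "\<And>i. i \<in> I \<Longrightarrow> distr M borel (Z i) = \<nu>"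
    and J: "finite J" "J \<subseteq> I" and K: "finite K" "K \<subseteq> I" and card: "card J = card K"
  shows "distr M borel (\<lambda>\<omega>. \<Sum>j\<in>J. Z j \<omega>) = distr M borel (\<lambda>\<omega>. \<Sum>j\<in>K. Z j \<omega>)"
proof (rule char_fn_unique)
  have rv: "Z j \<in> borel_measurable M" if "j \<in> I" for j
    using Z that by (simp add: indep_vars_def)
  show "finite_measure (distr M borel (\<lambda>\<omega>. \<Sum>j\<in>J. Z j \<omega>))" "finite_measure (distr M borel (\<lambda>\<omega>. \<Sum>j\<in>K. Z j \<omega>))"
    using J K rv by (auto intro!: finite_measure_distr borel_measurable_sum)
  show "char_fn (distr M borel (\<lambda>\<omega>. \<Sum>j\<in>J. Z j \<omega>)) z = char_fn (distr M borel (\<lambda>\<omega>. \<Sum>j\<in>K. Z j \<omega>)) z" for z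
    using char_fn_sum_iid[OF J(1) indep_vars_subset[OF Z J(2)]] char_fn_sum_iid[OF K(1) indep_vars_subset[OF Z K(2)]]
      J(2) K(2) \<nu> card by (simp add: subset_iff)
qed simp_all

lemma (in prob_space) indep_vars_disjoint_sums:
  fixes Z :: "'i \<Rightarrow> 'a \<Rightarrow> real ^ 'n"
  assumes Z: "indep_vars (\<lambda>_. borel) Z I" and K: "\<And>j. j \<in> L \<Longrightarrow> K j \<subseteq> I" "\<And>j. j \<in> L \<Longrightarrow> finite (K j)"
    and disj: "disjoint_family_on K L"
  shows "indep_vars (\<lambda>_. borel) (\<lambda>j \<omega>. \<Sum>i\<in>K j. Z i \<omega>) L"
proof -
  have "indep_vars (\<lambda>_. borel) (\<lambda>j \<omega>. (\<lambda>f. \<Sum>i\<in>K j. f i) (restrict (\<lambda>i. Z i \<omega>) (K j))) L"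
    by (rule indep_vars_compose2[OF indep_vars_restrict[OF Z K(1) disj]])
       (auto intro!: borel_measurable_sum measurable_component_singleton)
  then show ?thesis
    by (simp cong: sum.cong)
qed

text \<open>
  The probability generating function of the Poisson distribution, by the exponential series.
\<close>

lemma integral_power_poisson:
  fixes c :: complex
  assumes r: "r > 0" 
  shows "(CLINT k|measure_pmf (poisson_pmf r). c ^ k) = exp (complex_of_real r * (c - 1))"
proof -
  have pmf_term: "pmf (poisson_pmf r) k *\<^sub>R c ^ k = exp (- complex_of_real r) * ((complex_of_real r * c) ^ k /\<^sub>R fact k)" for k
    using r by (simp add: scaleR_conv_of_real power_mult_distrib field_simps exp_of_real[symmetric] flip: of_real_minus)
  have sums: "(\<lambda>k. pmf (poisson_pmf r) k *\<^sub>R c ^ k) sums (exp (- complex_of_real r) * exp (complex_of_real r * c))"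
    unfolding pmf_term by (intro sums_mult exp_converges)
  have "summable (\<lambda>k. norm (pmf (poisson_pmf r) k *\<^sub>R c ^ k))"
  proof -
    have "(\<lambda>k. norm (pmf (poisson_pmf r) k *\<^sub>R c ^ k)) = (\<lambda>k. norm (exp (- complex_of_real r)) * norm ((complex_of_real r * c) ^ k /\<^sub>R fact k))"
      unfolding pmf_term by (simp add: norm_mult mult_ac)
    then show ?thesis using summable_norm_exp[of "complex_of_real r * c"] by simp
  qed
  then have "integrable (count_space UNIV) (\<lambda>k. pmf (poisson_pmf r) k *\<^sub>R c ^ k)"
    unfolding integrable_count_space_nat_iff .
  then have "(\<integral>k. pmf (poisson_pmf r) k *\<^sub>R c ^ k \<partial>count_space UNIV) = exp (- complex_of_real r) * exp (complex_of_real r * c)"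
    using sums by (simp add: integral_count_space_nat sums_iff)
  moreover have "(CLINT k|measure_pmf (poisson_pmf r). c ^ k) = (\<integral>k. pmf (poisson_pmf r) k *\<^sub>R c ^ k \<partial>count_space UNIV)"
    unfolding measure_pmf_eq_density by (subst integral_density) auto
  ultimately show ?thesis by (simp add: exp_add[symmetric] algebra_simps)
qed

section \<open>Sums of independent Levy processes\<close>

lemma partition_mono:
  fixes t :: "nat \<Rightarrow> real"
  assumes "\<forall>i<n. t i < t (Suc i)" and "i \<le> j" "j \<le> n"
  shows "t i \<le> t j"
  using assms(2,3)
proof (induction j rule: dec_induct)
  case (step m)
  then show ?case using assms(1) by (smt (verit) Suc_le_lessD order_less_imp_le)
qed simp

lemma independent_incrementsD:
  assumes "independent_increments M X" and "0 \<le> t 0" "\<forall>i<n. t i < t (Suc i)"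
  shows "prob_space.indep_vars M (\<lambda>_. borel) (\<lambda>i \<omega>. X (t (Suc i)) \<omega> - X (t i) \<omega>) {..<n}"
  using assms unfolding independent_increments_def by blast

lemma (in prob_space) levy_process_cong:
  assumes X: "levy_process M X" and eq: "\<And>t \<omega>. 0 \<le> t \<Longrightarrow> \<omega> \<in> space M \<Longrightarrow> X t \<omega> = Y t \<omega>"
  shows "levy_process M Y"
  unfolding levy_process_def
proof (intro conjI allI impI)
  have X1: "\<And>t. 0 \<le> t \<Longrightarrow> X t \<in> borel_measurable M" and X2: "AE \<omega> in M. X 0 \<omega> = 0"
    and X3: "stochastically_continuous M X" and X4: "independent_increments M X" and X5: "stationary_increments M X"
    using X by (auto simp: levy_process_def)
  show "Y t \<in> borel_measurable M" if "0 \<le> t" for t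
    using X1[OF that] eq[OF that] by (simp cong: measurable_cong)
  show "AE \<omega> in M. Y 0 \<omega> = 0"
    using X2 AE_space by eventually_elim (simp add: eq[symmetric])
  have "{\<omega> \<in> space M. norm (X s \<omega> - X t \<omega>) > \<epsilon>} = {\<omega> \<in> space M. norm (Y s \<omega> - Y t \<omega>) > \<epsilon>}"
    if "s \<ge> 0" "t \<ge> 0" for s t \<epsilon>
    using that by (auto simp: eq)
  note ev = this
  show "stochastically_continuous M Y"
    unfolding stochastically_continuous_def
  proof (intro allI impI)
    fix t \<epsilon> :: real assume "0 \<le> t" "0 < \<epsilon>"
    then have lim: "((\<lambda>s. prob {\<omega> \<in> space M. norm (X s \<omega> - X t \<omega>) > \<epsilon>}) \<longlongrightarrow> 0) (at t within {0..})"
      using X3 by (simp add: stochastically_continuous_def)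
    show "((\<lambda>s. prob {\<omega> \<in> space M. norm (Y s \<omega> - Y t \<omega>) > \<epsilon>}) \<longlongrightarrow> 0) (at t within {0..})"
      by (rule Lim_transform_eventually[OF lim]) (use ev \<open>0 \<le> t\<close> in \<open>simp add: eventually_at_filter\<close>)
  qed
  show "independent_increments M Y"
    unfolding independent_increments_def
  proof (intro allI impI)
    fix n :: nat and t :: "nat \<Rightarrow> real" assume t: "0 \<le> t 0" "\<forall>i<n. t i < t (Suc i)"
    have pos: "0 \<le> t i" if "i \<le> n" for i
      using t(1) partition_mono[OF t(2) le0 that] by (rule order_trans)
    show "indep_vars (\<lambda>_. borel) (\<lambda>i \<omega>. Y (t (Suc i)) \<omega> - Y (t i) \<omega>) {..<n}"
    proof (rule indep_vars_cong_space)
      show "indep_vars (\<lambda>_. borel) (\<lambda>i \<omega>. X (t (Suc i)) \<omega> - X (t i) \<omega>) {..<n}"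
        by (rule independent_incrementsD[OF X4 t])
    qed (simp add: eq pos)
  qed
  show "stationary_increments M Y"
    unfolding stationary_increments_def
  proof (intro allI impI)
    fix s t :: real assume st: "0 \<le> s" "0 \<le> t"
    have "distr M borel (\<lambda>\<omega>. Y (s + t) \<omega> - Y s \<omega>) = distr M borel (\<lambda>\<omega>. X (s + t) \<omega> - X s \<omega>)"
      "distr M borel (\<lambda>\<omega>. Y t \<omega> - Y 0 \<omega>) = distr M borel (\<lambda>\<omega>. X t \<omega> - X 0 \<omega>)"
      using st by (auto intro!: distr_cong simp: eq)
    then show "distr M borel (\<lambda>\<omega>. Y (s + t) \<omega> - Y s \<omega>) = distr M borel (\<lambda>\<omega>. Y t \<omega> - Y 0 \<omega>)"
      using X5 st by (simp add: stationary_increments_def)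
  qed
qed

lemma (in prob_space) levy_process_zero: "levy_process M (\<lambda>_ _. 0)"
  by (auto simp: levy_process_def stochastically_continuous_def independent_increments_def stationary_increments_def
      intro!: indep_vars_borelI) (simp add: prob_space)

text \<open>
  The increments of the sum are sums of two independent families of independent increments, hence
  independent. Stationarity follows from the product formula for characteristic functions, and
  stochastic continuity from splitting \<open>\<epsilon>\<close> between the two processes.
\<close>

lemma (in prob_space) levy_process_add:
  fixes X Y :: "real \<Rightarrow> 'a \<Rightarrow> real ^ 'n"
  assumes X: "levy_process M X" and Y: "levy_process M Y"
    and indep: "indep_set (process_events M {0..} X) (process_events M {0..} Y)"
  shows "levy_process M (\<lambda>t \<omega>. X t \<omega> + Y t \<omega>)"
  unfolding levy_process_def
proof (intro conjI allI impI)
  let ?F = "process_algebra M {0..} X" and ?G = "process_algebra M {0..} Y"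
  have ind: "indep_set (sets ?F) (sets ?G)" using indep by simp
  have XF [measurable]: "X t \<in> borel_measurable ?F" and YG [measurable]: "Y t \<in> borel_measurable ?G" if "0 \<le> t" for t
    using that by (auto intro: measurable_process_algebra)
  have X1 [measurable]: "X t \<in> borel_measurable M" and Y1 [measurable]: "Y t \<in> borel_measurable M" if "0 \<le> t" for t
    using X Y that by (auto simp: levy_process_def)
  have X2: "AE \<omega> in M. X 0 \<omega> = 0" and X3: "stochastically_continuous M X" and X4: "independent_increments M X" and X5: "stationary_increments M X"
    using X by (auto simp: levy_process_def)
  have Y2: "AE \<omega> in M. Y 0 \<omega> = 0" and Y3: "stochastically_continuous M Y" and Y4: "independent_increments M Y" and Y5: "stationary_increments M Y"
    using Y by (auto simp: levy_process_def)
  show "(\<lambda>\<omega>. X t \<omega> + Y t \<omega>) \<in> borel_measurable M" if "0 \<le> t" for t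
    using X1[OF that] Y1[OF that] by simp
  show "AE \<omega> in M. X 0 \<omega> + Y 0 \<omega> = 0"
    using X2 Y2 by eventually_elim simp
  show "stochastically_continuous M (\<lambda>t \<omega>. X t \<omega> + Y t \<omega>)"
    unfolding stochastically_continuous_def
  proof (intro allI impI)
    fix t \<epsilon> :: real assume t: "0 \<le> t" and \<epsilon>: "0 < \<epsilon>"
    let ?p = "\<lambda>V s. prob {\<omega> \<in> space M. norm (V s \<omega> - V t \<omega> :: real ^ 'n) > \<epsilon> / 2}"
    have "((\<lambda>s. ?p X s + ?p Y s) \<longlongrightarrow> 0 + 0) (at t within {0..})"
      using X3[unfolded stochastically_continuous_def, rule_format, OF t half_gt_zero[OF \<epsilon>]]
        Y3[unfolded stochastically_continuous_def, rule_format, OF t half_gt_zero[OF \<epsilon>]]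
      by (rule tendsto_add)
    then have lim: "((\<lambda>s. ?p X s + ?p Y s) \<longlongrightarrow> 0) (at t within {0..})" by simp
    have le: "prob {\<omega> \<in> space M. norm ((X s \<omega> + Y s \<omega>) - (X t \<omega> + Y t \<omega>)) > \<epsilon>} \<le> ?p X s + ?p Y s" if s: "0 \<le> s" for s
    proof -
      note [measurable] = X1[OF s] X1[OF t] Y1[OF s] Y1[OF t]
      have "prob {\<omega> \<in> space M. norm ((X s \<omega> + Y s \<omega>) - (X t \<omega> + Y t \<omega>)) > \<epsilon>} \<le>
          prob ({\<omega> \<in> space M. norm (X s \<omega> - X t \<omega>) > \<epsilon> / 2} \<union> {\<omega> \<in> space M. norm (Y s \<omega> - Y t \<omega>) > \<epsilon> / 2})"
      proof (rule finite_measure_mono)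
        have "norm ((X s \<omega> + Y s \<omega>) - (X t \<omega> + Y t \<omega>)) \<le> norm (X s \<omega> - X t \<omega>) + norm (Y s \<omega> - Y t \<omega>)" for \<omega>
          using norm_triangle_ineq[of "X s \<omega> - X t \<omega>" "Y s \<omega> - Y t \<omega>"] by (simp add: algebra_simps)
        then show "{\<omega> \<in> space M. norm ((X s \<omega> + Y s \<omega>) - (X t \<omega> + Y t \<omega>)) > \<epsilon>} \<subseteq>
          {\<omega> \<in> space M. norm (X s \<omega> - X t \<omega>) > \<epsilon> / 2} \<union> {\<omega> \<in> space M. norm (Y s \<omega> - Y t \<omega>) > \<epsilon> / 2}"
          by (smt (verit) UnCI field_sum_of_halves mem_Collect_eq subsetI)
      qed simp
      also have "\<dots> \<le> ?p X s + ?p Y s" by (rule measure_Un_le) simp_all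
      finally show ?thesis .
    qed
    show "((\<lambda>s. prob {\<omega> \<in> space M. norm ((X s \<omega> + Y s \<omega>) - (X t \<omega> + Y t \<omega>)) > \<epsilon>}) \<longlongrightarrow> 0) (at t within {0..})"
    proof (rule tendsto_sandwich[OF _ _ tendsto_const lim])
      show "\<forall>\<^sub>F s in at t within {0..}. prob {\<omega> \<in> space M. norm ((X s \<omega> + Y s \<omega>) - (X t \<omega> + Y t \<omega>)) > \<epsilon>} \<le> ?p X s + ?p Y s"
        unfolding eventually_at_filter by (intro always_eventually) (use le in blast)
    qed simp
  qed
  show "independent_increments M (\<lambda>t \<omega>. X t \<omega> + Y t \<omega>)"
    unfolding independent_increments_def
  proof (intro allI impI)
    fix n :: nat and t :: "nat \<Rightarrow> real" assume t: "0 \<le> t 0" "\<forall>i<n. t i < t (Suc i)"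
    have pos: "0 \<le> t i" if "i \<le> n" for i
      using t(1) partition_mono[OF t(2) le0 that] by (rule order_trans)
    have "indep_vars (\<lambda>_. borel) (\<lambda>i \<omega>. (X (t (Suc i)) \<omega> - X (t i) \<omega>) + (Y (t (Suc i)) \<omega> - Y (t i) \<omega>)) {..<n}"
    proof (rule indep_vars_add_indep_families[OF _ _ _ ind])
      show "indep_vars (\<lambda>_. borel) (\<lambda>i \<omega>. X (t (Suc i)) \<omega> - X (t i) \<omega>) {..<n}"
        by (rule independent_incrementsD[OF X4 t])
      show "indep_vars (\<lambda>_. borel) (\<lambda>i \<omega>. Y (t (Suc i)) \<omega> - Y (t i) \<omega>) {..<n}"
        by (rule independent_incrementsD[OF Y4 t])
    qed (auto intro!: borel_measurable_diff XF YG pos)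
    then show "indep_vars (\<lambda>_. borel) (\<lambda>i \<omega>. (X (t (Suc i)) \<omega> + Y (t (Suc i)) \<omega>) - (X (t i) \<omega> + Y (t i) \<omega>)) {..<n}"
      by (simp add: algebra_simps)
  qed
  show "stationary_increments M (\<lambda>t \<omega>. X t \<omega> + Y t \<omega>)"
    unfolding stationary_increments_def
  proof (intro allI impI)
    fix s t :: real assume st: "0 \<le> s" "0 \<le> t"
    have ch: "char_fn (distr M borel (\<lambda>\<omega>. (X u \<omega> + Y u \<omega>) - (X v \<omega> + Y v \<omega>))) z =
        char_fn (distr M borel (\<lambda>\<omega>. X u \<omega> - X v \<omega>)) z * char_fn (distr M borel (\<lambda>\<omega>. Y u \<omega> - Y v \<omega>)) z"
      if "0 \<le> u" "0 \<le> v" for u v z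
    proof -
      have "(\<lambda>\<omega>. (X u \<omega> + Y u \<omega>) - (X v \<omega> + Y v \<omega>)) = (\<lambda>\<omega>. (X u \<omega> - X v \<omega>) + (Y u \<omega> - Y v \<omega>))"
        by (simp add: algebra_simps)
      then show ?thesis
        using that by (simp only:) (intro char_fn_add[OF ind] borel_measurable_diff XF YG, auto)
    qed
    show "distr M borel (\<lambda>\<omega>. (X (s + t) \<omega> + Y (s + t) \<omega>) - (X s \<omega> + Y s \<omega>)) =
      distr M borel (\<lambda>\<omega>. (X t \<omega> + Y t \<omega>) - (X 0 \<omega> + Y 0 \<omega>))"
    proof (rule char_fn_unique)
      show "char_fn (distr M borel (\<lambda>\<omega>. (X (s + t) \<omega> + Y (s + t) \<omega>) - (X s \<omega> + Y s \<omega>))) z =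
        char_fn (distr M borel (\<lambda>\<omega>. (X t \<omega> + Y t \<omega>) - (X 0 \<omega> + Y 0 \<omega>))) z" for z
        using st X5 Y5 by (simp add: ch stationary_increments_def)
    qed (use st X1 Y1 in \<open>auto intro!: finite_measure_distr borel_measurable_diff borel_measurable_add\<close>)
  qed
qed

section \<open>Compound Poisson processes\<close>

lemma nat_measurable_iff:
  fixes f :: "'a \<Rightarrow> nat"
  shows "f \<in> borel_measurable M \<longleftrightarrow> f \<in> measurable M (count_space UNIV)"
  by (simp only: measurable_cong_sets[OF refl sets_borel_eq_count_space])

locale compound_poisson = prob_space M for M :: "'w measure" +
  fixes rate :: real and \<nu> :: "(real ^ 'n) measure"
    and N :: "real \<Rightarrow> 'w \<Rightarrow> nat" and Z :: "nat \<Rightarrow> 'w \<Rightarrow> real ^ 'n"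
  assumes rate_pos: "rate > 0"
    and poisson: "poisson_process M rate N"
    and jumps_indep: "indep_vars (\<lambda>_. borel) Z {1..}"
    and jumps_distr: "\<And>i. i \<ge> 1 \<Longrightarrow> distr M borel (Z i) = \<nu>"
    and count_jumps_indep: "indep_set (process_events M {0..} N) (process_events M {1..} Z)"
begin

definition jump_sum :: "real \<Rightarrow> 'w \<Rightarrow> real ^ 'n" where
  "jump_sum t \<omega> = (\<Sum>i = 1..N t \<omega>. Z i \<omega>)"

abbreviation "jump_algebra \<equiv> process_algebra M {1..} Z"
abbreviation "count_algebra \<equiv> process_algebra M {0..} N"

lemma jump_count_indep: "indep_set (sets jump_algebra) (sets count_algebra)"
  using indep_set_commute[OF count_jumps_indep] by simp

lemma jumps_measurable: "i \<ge> 1 \<Longrightarrow> Z i \<in> borel_measurable M"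
  using jumps_indep by (simp add: indep_vars_def)

lemma count_measurable: "t \<ge> 0 \<Longrightarrow> N t \<in> borel_measurable M"
  using poisson by (simp add: poisson_process_def)

lemma count_0_AE: "AE \<omega> in M. N 0 \<omega> = 0"
  using poisson by (auto simp: poisson_process_def)

lemma count_mono_AE: "AE \<omega> in M. \<forall>s t. 0 \<le> s \<longrightarrow> s \<le> t \<longrightarrow> N s \<omega> \<le> N t \<omega>"
proof -
  have "AE \<omega> in M. mono_on {0..} (\<lambda>t. N t \<omega>)"
    using poisson by (auto simp: poisson_process_def)
  then show ?thesis by eventually_elim (auto simp: mono_on_def)
qed

text \<open>
  The jumps \<open>x\<close> and the counts \<open>y\<close> are decoupled here, in the form that freezing requires: the
  compound sum is the diagonal value \<open>x = y\<close>.
\<close>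

lemma random_sum_measurable:
  assumes "0 \<le> t"
  shows "(\<lambda>(x, y). \<Sum>i = 1..N t y. Z i x) \<in> borel_measurable (jump_algebra \<Otimes>\<^sub>M count_algebra)"
proof -
  have N: "N t \<in> measurable count_algebra (count_space UNIV)"
    using measurable_process_algebra[of t "{0..}" N M] assms
    by (simp add: nat_measurable_iff)
  have "(\<lambda>p. \<Sum>i = 1..N t (snd p). Z i (fst p)) \<in> borel_measurable (jump_algebra \<Otimes>\<^sub>M count_algebra)"
  proof (rule measurable_compose_countable[where f="\<lambda>n p. \<Sum>i = 1..n. Z i (fst p)"])
    show "(\<lambda>p. \<Sum>i = 1..n. Z i (fst p)) \<in> borel_measurable (jump_algebra \<Otimes>\<^sub>M count_algebra)" for n
      by (intro borel_measurable_sum measurable_compose[OF measurable_fst] measurable_process_algebra) simp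
    show "(\<lambda>p. N t (snd p)) \<in> measurable (jump_algebra \<Otimes>\<^sub>M count_algebra) (count_space UNIV)"
      by (rule measurable_compose[OF measurable_snd N])
  qed
  then show ?thesis by (simp add: split_beta')
qed

lemma jump_sum_measurable:
  assumes "0 \<le> t" shows "jump_sum t \<in> borel_measurable M"
proof -
  have "(\<lambda>\<omega>. \<Sum>i = 1..N t \<omega>. Z i \<omega>) \<in> borel_measurable M"
  proof (rule measurable_compose_countable[where f="\<lambda>n \<omega>. \<Sum>i = 1..n. Z i \<omega>"])
    show "(\<lambda>\<omega>. \<Sum>i = 1..n. Z i \<omega>) \<in> borel_measurable M" for n
      by (intro borel_measurable_sum jumps_measurable) simp
    show "N t \<in> measurable M (count_space UNIV)"
      using count_measurable[OF assms] by (simp add: nat_measurable_iff)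
  qed
  then show ?thesis by (simp add: jump_sum_def[abs_def])
qed

lemma jump_block:
  assumes "a \<le> b"
  shows "(\<Sum>i = 1..b. Z i x) - (\<Sum>i = 1..a. Z i x) = (\<Sum>i\<in>{a<..b}. Z i x)"
proof -
  have "{1..b} = {1..a} \<union> {a<..b}" using assms by auto
  moreover have "(\<Sum>i\<in>{1..a} \<union> {a<..b}. Z i x) = (\<Sum>i = 1..a. Z i x) + (\<Sum>i\<in>{a<..b}. Z i x)"
    by (rule sum.union_disjoint) auto
  ultimately show ?thesis by simp
qed

lemma distr_jump_block:
  assumes "a \<le> b"
  shows "distr M borel (\<lambda>x. \<Sum>i\<in>{a<..b}. Z i x) = distr M borel (\<lambda>x. \<Sum>i = 1..b - a. Z i x)"
  by (rule distr_sum_iid_cong[OF jumps_indep jumps_distr]) (use assms in auto)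

text \<open>
  With the count path frozen, increments over disjoint time intervals sum the jumps over disjoint
  blocks of indices. These sums are independent, and by \<open>distr_jump_block\<close> the law of each depends
  only on the increment of the count, so \<open>indep_vars_freezing\<close> reduces the claim to the independent
  increments of \<open>N\<close>.
\<close>

lemma independent_increments_jump_sum: "independent_increments M jump_sum"
  unfolding independent_increments_def
proof (intro allI impI)
  fix n :: nat and t :: "nat \<Rightarrow> real" assume t: "0 \<le> t 0" "\<forall>i<n. t i < t (Suc i)"
  have pos: "0 \<le> t i" if "i \<le> n" for i
    using t(1) partition_mono[OF t(2) le0 that] by (rule order_trans)
  define W where "W i x y = (\<Sum>j = 1..N (t (Suc i)) y. Z j x) - (\<Sum>j = 1..N (t i) y. Z j x)" for i x y
  define q where "q i B k = expectation (\<lambda>x. indicator B (\<Sum>j = 1..k. Z j x) :: real)" for i :: nat and B :: "(real ^ 'n) set" and k :: nat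
  have mono: "N (t i) y \<le> N (t j) y"
    if "\<forall>s t. 0 \<le> s \<longrightarrow> s \<le> t \<longrightarrow> N s y \<le> N t y" "i \<le> j" "j \<le> n" for i j y
    using that(1) pos[of i] partition_mono[OF t(2) that(2,3)] that(2,3) by (meson order_trans)
  have "indep_vars (\<lambda>_. borel) (\<lambda>i \<omega>. W i \<omega> \<omega>) {..<n}"
  proof (rule indep_vars_freezing[OF _ _ _ jump_count_indep, where W=W and q=q])
    show "(\<lambda>(x, y). W i x y) \<in> borel_measurable (jump_algebra \<Otimes>\<^sub>M count_algebra)" if "i \<in> {..<n}" for i
    proof -
      have "0 \<le> t i" "0 \<le> t (Suc i)" using pos that by auto
      from random_sum_measurable[OF this(2)] random_sum_measurable[OF this(1)]
      show ?thesis unfolding W_def split_beta' by (rule borel_measurable_diff)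
    qed
    show "AE y in M. indep_vars (\<lambda>_. borel) (\<lambda>i x. W i x y) {..<n}"
      using count_mono_AE
    proof eventually_elim
      case (elim y)
      let ?K = "\<lambda>i. {N (t i) y <.. N (t (Suc i)) y}"
      have "?K i \<inter> ?K j = {}" if "i < j" "j < n" for i j
        using mono[OF elim, of "Suc i" j] that by auto
      then have disj: "disjoint_family_on ?K {..<n}"
        unfolding disjoint_family_on_def by (metis Int_commute lessThan_iff nat_neq_iff)
      have "indep_vars (\<lambda>_. borel) (\<lambda>i x. \<Sum>j\<in>?K i. Z j x) {..<n}"
        by (rule indep_vars_disjoint_sums[OF jumps_indep _ _ disj]) auto
      then show ?case
        by (rule indep_vars_cong_space, unfold W_def, subst jump_block) (simp_all add: mono[OF elim])
    qed
    show "indep_vars (\<lambda>_. borel) (\<lambda>i y. N (t (Suc i)) y - N (t i) y) {..<n}"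
      by (rule independent_incrementsD[OF _ t]) (use poisson in \<open>simp add: poisson_process_def\<close>)
    show "q i B \<in> borel_measurable borel" for i B
      by (simp add: measurable_cong_sets[OF sets_borel_eq_count_space refl])
    show "AE y in M. expectation (\<lambda>x. indicator B (W i x y) :: real) = q i B (N (t (Suc i)) y - N (t i) y)"
      if i: "i \<in> {..<n}" and B [measurable]: "B \<in> sets borel" for i B
      using count_mono_AE
    proof eventually_elim
      case (elim y)
      let ?a = "N (t i) y" and ?b = "N (t (Suc i)) y"
      have ab: "?a \<le> ?b" using mono[OF elim, of i "Suc i"] i by simp
      have E: "expectation (\<lambda>x. indicator B (\<Sum>j\<in>J. Z j x) :: real) = measure (distr M borel (\<lambda>x. \<Sum>j\<in>J. Z j x)) B"
        if "J \<subseteq> {1..}" for J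
      proof -
        have [measurable]: "(\<lambda>x. \<Sum>j\<in>J. Z j x) \<in> borel_measurable M"
          using that by (intro borel_measurable_sum jumps_measurable) auto
        have "expectation (\<lambda>x. indicator B (\<Sum>j\<in>J. Z j x) :: real) = (\<integral>v. indicator B v \<partial>distr M borel (\<lambda>x. \<Sum>j\<in>J. Z j x))"
          by (subst integral_distr) auto
        then show ?thesis by simp
      qed
      show ?case
        unfolding W_def q_def jump_block[OF ab]
        using distr_jump_block[OF ab] E[of "{?a<..?b}"] E[of "{1..?b - ?a}"] by (simp add: subset_eq)
    qed
  qed simp_all
  then show "indep_vars (\<lambda>_. borel) (\<lambda>i \<omega>. jump_sum (t (Suc i)) \<omega> - jump_sum (t i) \<omega>) {..<n}"
    by (simp add: W_def jump_sum_def)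
qed

lemma count_distr:
  assumes "0 \<le> s" "s < t"
  shows "distr M (count_space UNIV) (\<lambda>\<omega>. N t \<omega> - N s \<omega>) = measure_pmf (poisson_pmf (rate * (t - s)))"
  using poisson assms by (simp add: poisson_process_def)

lemma count_increment_measurable:
  assumes "0 \<le> s" "0 \<le> t"
  shows "(\<lambda>\<omega>. N t \<omega> - N s \<omega>) \<in> measurable M (count_space UNIV)"
proof -
  note [measurable] = count_measurable[OF assms(1), unfolded nat_measurable_iff]
    count_measurable[OF assms(2), unfolded nat_measurable_iff]
  show ?thesis by measurable
qed

text \<open>
  Truncated subtraction makes the event \<open>N t \<le> N s\<close>, which almost surely is \<open>N t = N s\<close>.
\<close>

lemma prob_no_count_increment:
  assumes "0 \<le> s" "s < t"
  shows "prob {\<omega> \<in> space M. N t \<omega> - N s \<omega> = 0} = exp (- rate * (t - s))"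
proof -
  have "prob {\<omega> \<in> space M. N t \<omega> - N s \<omega> = 0} = measure (distr M (count_space UNIV) (\<lambda>\<omega>. N t \<omega> - N s \<omega>)) {0}"
    using count_increment_measurable[of s t] assms
    by (subst measure_distr) (auto intro!: arg_cong[where f=prob])
  also have "\<dots> = exp (- rate * (t - s))"
    using assms rate_pos by (simp add: count_distr measure_pmf_single)
  finally show ?thesis .
qed

text \<open>
  With the counts frozen, an increment is a sum of \<open>N t - N s\<close> iid jumps, so its characteristic
  function is a power of that of \<open>\<nu>\<close>; averaging over the Poisson exponent gives the exponential. The
  degenerate case \<open>s = t\<close> is separate because the Poisson law requires a positive rate.
\<close>

lemma char_fn_jump_sum_increment:
  assumes st: "0 \<le> s" "s \<le> t"
  shows "char_fn (distr M borel (\<lambda>\<omega>. jump_sum t \<omega> - jump_sum s \<omega>)) z =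
    exp (complex_of_real (rate * (t - s)) * (char_fn \<nu> z - 1))"
proof (cases "s = t")
  case True
  then show ?thesis
    by (subst char_fn_distr) (simp_all add: prob_space)
next
  case False
  with st have less: "s < t" and t: "0 \<le> t" by auto
  note meas = random_sum_measurable[OF t] random_sum_measurable[OF st(1)]
  have D: "(\<lambda>(x, y). (\<Sum>i = 1..N t y. Z i x) - (\<Sum>i = 1..N s y. Z i x)) \<in> borel_measurable (jump_algebra \<Otimes>\<^sub>M count_algebra)"
    using meas unfolding split_beta' by (rule borel_measurable_diff)
  let ?f = "\<lambda>x y. iexp (z \<bullet> ((\<Sum>i = 1..N t y. Z i x) - (\<Sum>i = 1..N s y. Z i x)))"
  have f: "(\<lambda>(x, y). ?f x y) \<in> borel_measurable (jump_algebra \<Otimes>\<^sub>M count_algebra)"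
    using measurable_compose[OF D, of "\<lambda>v. iexp (z \<bullet> v)" borel] by (simp add: split_beta')
  have "char_fn (distr M borel (\<lambda>\<omega>. jump_sum t \<omega> - jump_sum s \<omega>)) z = (CLINT \<omega>|M. ?f \<omega> \<omega>)"
    unfolding jump_sum_def[symmetric]
    by (intro char_fn_distr borel_measurable_diff jump_sum_measurable st t)
  also have "\<dots> = (CLINT y|M. CLINT x|M. ?f x y)"
    by (rule freezing(3)[OF _ _ jump_count_indep f, where C=1]) simp_all
  also have "\<dots> = (CLINT y|M. char_fn \<nu> z ^ (N t y - N s y))"
  proof (rule integral_cong_AE)
    have id: "(\<lambda>x. x) \<in> measurable M count_algebra"
      using indep_setD_ev2[OF jump_count_indep] sets.sets_into_space
      by (auto simp: measurable_def intro: sets.Int_space_eq2 sets.Int)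
    show "(\<lambda>y. CLINT x|M. ?f x y) \<in> borel_measurable M"
      by (rule measurable_compose[OF id freezing(2)[OF _ _ jump_count_indep f, where C=1]]) simp_all
    show "(\<lambda>y. char_fn \<nu> z ^ (N t y - N s y)) \<in> borel_measurable M"
      by (rule measurable_compose[OF count_increment_measurable[OF st(1) t]]) simp
    show "AE y in M. (CLINT x|M. ?f x y) = char_fn \<nu> z ^ (N t y - N s y)"
      using count_mono_AE
    proof eventually_elim
      case (elim y)
      have ab: "N s y \<le> N t y" using elim st by blast
      let ?J = "{N s y <.. N t y}"
      have "(CLINT x|M. ?f x y) = (CLINT x|M. iexp (z \<bullet> (\<Sum>i\<in>?J. Z i x)))"
        by (simp only: jump_block[OF ab])
      also have "\<dots> = char_fn (distr M borel (\<lambda>x. \<Sum>i\<in>?J. Z i x)) z"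
        by (rule char_fn_distr[symmetric]) (auto intro!: borel_measurable_sum jumps_measurable)
      also have "\<dots> = char_fn \<nu> z ^ card ?J"
        by (rule char_fn_sum_iid[OF _ indep_vars_subset[OF jumps_indep] jumps_distr]) auto
      finally show ?case by simp
    qed
  qed
  also have "\<dots> = (CLINT k|distr M (count_space UNIV) (\<lambda>\<omega>. N t \<omega> - N s \<omega>). char_fn \<nu> z ^ k)"
    by (rule integral_distr[symmetric]) (use count_increment_measurable[OF st(1) t] in auto)
  also have "\<dots> = exp (complex_of_real (rate * (t - s)) * (char_fn \<nu> z - 1))"
    unfolding count_distr[OF st(1) less] using less rate_pos by (intro integral_power_poisson) simp
  finally show ?thesis .
qed

lemma jump_sum_0_AE: "AE \<omega> in M. jump_sum 0 \<omega> = 0"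
  using count_0_AE by eventually_elim (simp add: jump_sum_def)

lemma char_fn_jump_sum:
  assumes "0 \<le> t"
  shows "char_fn (distr M borel (jump_sum t)) z = exp (complex_of_real (rate * t) * (char_fn \<nu> z - 1))"
proof -
  have "distr M borel (jump_sum t) = distr M borel (\<lambda>\<omega>. jump_sum t \<omega> - jump_sum 0 \<omega>)"
    using jump_sum_0_AE jump_sum_measurable assms
    by (intro distr_cong_AE) (auto elim: eventually_mono)
  then show ?thesis using char_fn_jump_sum_increment[of 0 t z] assms by simp
qed

text \<open>
  Almost surely, the process changes between \<open>s\<close> and \<open>t\<close> only if at least one jump occurs.
\<close>

lemma prob_jump_sum_neq_le:
  assumes "0 \<le> s" "s < t"
  shows "prob {\<omega> \<in> space M. jump_sum s \<omega> \<noteq> jump_sum t \<omega>} \<le> 1 - exp (- rate * (t - s))"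
proof -
  let ?A = "{\<omega> \<in> space M. N t \<omega> - N s \<omega> = 0}"
  have A: "?A \<in> events"
    using measurable_sets[OF count_increment_measurable[of s t], of "{0}"] assms
    by (simp add: vimage_def Int_def conj_commute)
  have "prob {\<omega> \<in> space M. jump_sum s \<omega> \<noteq> jump_sum t \<omega>} \<le> prob (space M - ?A)"
  proof (rule finite_measure_mono_AE)
    show "AE \<omega> in M. \<omega> \<in> {\<omega> \<in> space M. jump_sum s \<omega> \<noteq> jump_sum t \<omega>} \<longrightarrow> \<omega> \<in> space M - ?A"
      using count_mono_AE
    proof eventually_elim
      case (elim \<omega>)
      have "N s \<omega> \<le> N t \<omega>" using elim assms by simp
      then show ?case by (auto simp: jump_sum_def)
    qed
  qed (use A in auto)
  also have "\<dots> = 1 - exp (- rate * (t - s))"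
    using A prob_compl[OF A] prob_no_count_increment[OF assms] by simp
  finally show ?thesis .
qed

lemma stochastically_continuous_jump_sum: "stochastically_continuous M jump_sum"
  unfolding stochastically_continuous_def
proof (intro allI impI)
  fix t \<epsilon> :: real assume t: "0 \<le> t" and \<epsilon>: "0 < \<epsilon>"
  have le: "prob {\<omega> \<in> space M. norm (jump_sum s \<omega> - jump_sum t \<omega>) > \<epsilon>} \<le> 1 - exp (- rate * \<bar>t - s\<bar>)"
    if s: "0 \<le> s" for s
  proof (cases "s = t")
    case True
    then show ?thesis using \<epsilon> by simp
  next
    case False
    note [measurable] = jump_sum_measurable[OF s] jump_sum_measurable[OF t]
    have "prob {\<omega> \<in> space M. norm (jump_sum s \<omega> - jump_sum t \<omega>) > \<epsilon>} \<le> prob {\<omega> \<in> space M. jump_sum s \<omega> \<noteq> jump_sum t \<omega>}"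
      using \<epsilon> by (intro finite_measure_mono) auto
    also have "\<dots> \<le> 1 - exp (- rate * \<bar>t - s\<bar>)"
    proof (cases "s < t")
      case True
      then show ?thesis using prob_jump_sum_neq_le[OF s True] by simp
    next
      case nless: False
      with False have "t < s" by simp
      then show ?thesis using prob_jump_sum_neq_le[OF t] by (simp add: eq_commute)
    qed
    finally show ?thesis .
  qed
  have "((\<lambda>s. 1 - exp (- rate * \<bar>t - s\<bar>)) \<longlongrightarrow> 1 - exp (- rate * \<bar>t - t\<bar>)) (at t within {0..})"
    by (intro tendsto_intros)
  then have lim: "((\<lambda>s. 1 - exp (- rate * \<bar>t - s\<bar>)) \<longlongrightarrow> 0) (at t within {0..})" by simp
  show "((\<lambda>s. prob {\<omega> \<in> space M. norm (jump_sum s \<omega> - jump_sum t \<omega>) > \<epsilon>}) \<longlongrightarrow> 0) (at t within {0..})"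
  proof (rule tendsto_sandwich[OF _ _ tendsto_const lim])
    show "\<forall>\<^sub>F s in at t within {0..}. prob {\<omega> \<in> space M. norm (jump_sum s \<omega> - jump_sum t \<omega>) > \<epsilon>} \<le> 1 - exp (- rate * \<bar>t - s\<bar>)"
      unfolding eventually_at_filter by (intro always_eventually) (use le in blast)
  qed simp
qed

lemma levy_process_jump_sum: "levy_process M jump_sum"
  unfolding levy_process_def
proof (intro conjI allI impI)
  show "stationary_increments M jump_sum"
    unfolding stationary_increments_def
  proof (intro allI impI)
    fix s t :: real assume st: "0 \<le> s" "0 \<le> t"
    show "distr M borel (\<lambda>\<omega>. jump_sum (s + t) \<omega> - jump_sum s \<omega>) = distr M borel (\<lambda>\<omega>. jump_sum t \<omega> - jump_sum 0 \<omega>)"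
    proof (rule char_fn_unique)
      show "char_fn (distr M borel (\<lambda>\<omega>. jump_sum (s + t) \<omega> - jump_sum s \<omega>)) z =
          char_fn (distr M borel (\<lambda>\<omega>. jump_sum t \<omega> - jump_sum 0 \<omega>)) z" for z
        using st by (simp add: char_fn_jump_sum_increment)
    qed (use st jump_sum_measurable in \<open>auto intro!: finite_measure_distr borel_measurable_diff\<close>)
  qed
qed (fact jump_sum_measurable jump_sum_0_AE stochastically_continuous_jump_sum independent_increments_jump_sum)+

lemma prob_jump_sum_zero_ge:
  assumes "0 \<le> t"
  shows "exp (- rate * t) \<le> prob {\<omega> \<in> space M. jump_sum t \<omega> = 0}"
proof -
  note [measurable] = jump_sum_measurable[OF assms]
  have "exp (- rate * t) \<le> prob {\<omega> \<in> space M. N t \<omega> - N 0 \<omega> = 0}"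
    using prob_no_count_increment[of 0 t] assms prob_space by (cases "t = 0") auto
  also have "\<dots> \<le> prob {\<omega> \<in> space M. jump_sum t \<omega> = 0}"
  proof (rule finite_measure_mono_AE)
    show "AE \<omega> in M. \<omega> \<in> {\<omega> \<in> space M. N t \<omega> - N 0 \<omega> = 0} \<longrightarrow> \<omega> \<in> {\<omega> \<in> space M. jump_sum t \<omega> = 0}"
      using count_0_AE by eventually_elim (auto simp: jump_sum_def)
  qed simp
  finally show ?thesis .
qed

end

section \<open>Thinning a Levy measure\<close>

lemma scale_measure_eq_density: "scale_measure r M = density M (\<lambda>_. r)"
  by (rule measure_eqI) (simp_all add: emeasure_density nn_integral_cmult_indicator)

text \<open>
  Pointwise, the integrand of \<open>L\<close> is \<open>g\<close> times itself, plus \<open>(1 - g) (exp (\<i> \<langle>z, x\<rangle>) - 1)\<close>, minus the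
  compensator weighted by \<open>1 - g\<close>. The bound \<open>A2\<close> makes the last two terms separately integrable, and
  the integral of the compensator is \<open>\<i> \<langle>b - b', z\<rangle>\<close>.
\<close>

lemma levy_exponent_thinning:
  fixes L :: "(real ^ 'n) measure"
  assumes L: "levy_measure L" and h: "h_function L h"
    and g [measurable]: "g \<in> borel_measurable borel" and A1: "\<And>x. 0 \<le> g x \<and> g x \<le> 1"
    and A2: "(\<integral>\<^sup>+ x. ennreal (max (norm (h x *\<^sub>R x)) 1 * (1 - g x)) \<partial>L) < \<infinity>"
    and b': "b' = b - (LINT x|L. (h x * (1 - g x)) *\<^sub>R x)"
  shows "levy_exponent A L b h z = levy_exponent A (density L (\<lambda>x. ennreal (g x))) b' h z +
      (CLINT x|density L (\<lambda>x. ennreal (1 - g x)). iexp (z \<bullet> x) - 1)"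
proof -
  have [measurable_cong]: "sets L = sets borel" using L by (simp add: levy_measure_def)
  have [measurable]: "h \<in> borel_measurable borel" using h by (simp add: h_function_def)
  let ?e = "\<lambda>x. iexp (z \<bullet> x) - 1 - \<i> * complex_of_real ((z \<bullet> x) * h x)"
  let ?v = "\<lambda>x. (h x * (1 - g x)) *\<^sub>R x"
  have inte: "integrable L ?e"
    using h by (intro integrableI_bounded) (auto simp: h_function_def)
  have dom: "integrable L (\<lambda>x. max (norm (h x *\<^sub>R x)) 1 * (1 - g x))"
    using A2 A1 by (intro integrableI_bounded) (auto simp: abs_mult max_def cong: nn_integral_cong)
  have intge: "integrable L (\<lambda>x. g x *\<^sub>R ?e x)"
    using A1 by (intro Bochner_Integration.integrable_bound[OF inte]) (auto simp: mult_left_le_one_le)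
  have intv: "integrable L ?v"
  proof (rule Bochner_Integration.integrable_bound[OF dom])
    show "AE x in L. norm (?v x) \<le> norm (max (norm (h x *\<^sub>R x)) 1 * (1 - g x))"
    proof (rule AE_I2)
      fix x
      have "norm (?v x) = norm (h x *\<^sub>R x) * (1 - g x)"
        using A1[of x] by (simp add: abs_mult)
      also have "\<dots> \<le> max (norm (h x *\<^sub>R x)) 1 * (1 - g x)"
        using A1[of x] by (intro mult_right_mono) auto
      finally show "norm (?v x) \<le> norm (max (norm (h x *\<^sub>R x)) 1 * (1 - g x))" by simp
    qed
  qed simp
  have intw: "integrable L (\<lambda>x. (1 - g x) *\<^sub>R (iexp (z \<bullet> x) - 1))"
  proof (rule Bochner_Integration.integrable_bound[OF integrable_mult_right[OF dom, of 2]])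
    show "AE x in L. norm ((1 - g x) *\<^sub>R (iexp (z \<bullet> x) - 1)) \<le> norm (2 * (max (norm (h x *\<^sub>R x)) 1 * (1 - g x)))"
    proof (rule AE_I2)
      fix x
      have "norm (iexp (z \<bullet> x) - 1) \<le> 2"
        using norm_triangle_ineq4[of "iexp (z \<bullet> x)" 1] by simp
      also have "\<dots> \<le> 2 * max (norm (h x *\<^sub>R x)) 1" by simp
      finally have "(1 - g x) * norm (iexp (z \<bullet> x) - 1) \<le> (1 - g x) * (2 * max (norm (h x *\<^sub>R x)) 1)"
        using A1[of x] by (intro mult_left_mono) auto
      then have "norm ((1 - g x) *\<^sub>R (iexp (z \<bullet> x) - 1)) \<le> 2 * (max (norm (h x *\<^sub>R x)) 1 * (1 - g x))"
        using A1[of x] by (simp add: mult_ac)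
      then show "norm ((1 - g x) *\<^sub>R (iexp (z \<bullet> x) - 1)) \<le> norm (2 * (max (norm (h x *\<^sub>R x)) 1 * (1 - g x)))"
        by (rule order_trans) simp
    qed
  qed simp
  have intvz: "integrable L (\<lambda>x. ?v x \<bullet> z)"
    using intv by (rule integrable_inner_left)
  have split: "?e x = g x *\<^sub>R ?e x + (1 - g x) *\<^sub>R (iexp (z \<bullet> x) - 1) - \<i> * complex_of_real (?v x \<bullet> z)" for x
  proof -
    have "?v x \<bullet> z = h x * (1 - g x) * (z \<bullet> x)" by (simp add: inner_commute)
    then show ?thesis by (simp only:) (simp add: scaleR_conv_of_real algebra_simps)
  qed
  have "(CLINT x|L. ?e x) = (CLINT x|L. g x *\<^sub>R ?e x + (1 - g x) *\<^sub>R (iexp (z \<bullet> x) - 1) - \<i> * complex_of_real (?v x \<bullet> z))"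
    by (intro Bochner_Integration.integral_cong refl split)
  also have "\<dots> = (CLINT x|L. g x *\<^sub>R ?e x) + (CLINT x|L. (1 - g x) *\<^sub>R (iexp (z \<bullet> x) - 1)) - \<i> * complex_of_real (LINT x|L. ?v x \<bullet> z)"
  proof -
    have "integrable L (\<lambda>x. \<i> * complex_of_real (?v x \<bullet> z))"
      by (intro integrable_mult_right integrable_of_real intvz)
    then show ?thesis
      using intge intw intvz
      by (simp only: Bochner_Integration.integral_diff Bochner_Integration.integral_add Bochner_Integration.integrable_add
          integral_mult_right_zero integral_of_real)
  qed
  also have "(LINT x|L. ?v x \<bullet> z) = (b - b') \<bullet> z"
    using intv by (subst integral_inner_left) (simp_all add: b')
  also have "(CLINT x|L. g x *\<^sub>R ?e x) = (CLINT x|density L (\<lambda>x. ennreal (g x)). ?e x)"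
    using A1 by (intro integral_density[symmetric]) auto
  also have "(CLINT x|L. (1 - g x) *\<^sub>R (iexp (z \<bullet> x) - 1)) = (CLINT x|density L (\<lambda>x. ennreal (1 - g x)). iexp (z \<bullet> x) - 1)"
    using A1 by (intro integral_density[symmetric]) auto
  finally show ?thesis
    by (simp add: levy_exponent_def inner_diff_left algebra_simps)
qed

theorem theorem1:
  fixes A :: "real ^ 'n ^ 'n"
    and L L' \<rho> \<mu> \<mu>' :: "(real ^ 'n) measure"
    and b b' :: "real ^ 'n"
    and h g :: "real ^ 'n \<Rightarrow> real"
    and \<eta> :: real
    and M :: "'w measure"
    and N :: "real \<Rightarrow> 'w \<Rightarrow> nat"
    and Z :: "nat \<Rightarrow> 'w \<Rightarrow> real ^ 'n"
    and T :: "'w \<Rightarrow> ereal"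
    and V X X' :: "real \<Rightarrow> 'w \<Rightarrow> real ^ 'n"
  assumes A: "covariance_matrix A"
    and L: "levy_measure L"
    and h: "h_function L h"
    and \<mu>: "is_ID A L b h \<mu>"
    and g: "g \<in> borel_measurable borel"
    and A1: "\<And>x. 0 \<le> g x \<and> g x \<le> 1"
    and A2: "(\<integral>\<^sup>+ x. ennreal (max (norm (h x *\<^sub>R x)) 1 * (1 - g x)) \<partial>L) < \<infinity>"
    and L': "L' = density L (\<lambda>x. ennreal (g x))"
    and b': "b' = b - (LINT x|L. (h x * (1 - g x)) *\<^sub>R x)"
    and \<mu>': "is_ID A L' b' h \<mu>'"
    and \<rho>: "\<rho> = density L (\<lambda>x. ennreal (1 - g x))"
    and \<eta>: "\<eta> = measure \<rho> UNIV"
    and M: "prob_space M"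
    and N: "\<eta> \<noteq> 0 \<Longrightarrow> poisson_process M \<eta> N"
    and Z_indep: "\<eta> \<noteq> 0 \<Longrightarrow> prob_space.indep_vars M (\<lambda>_. borel) Z {1..}"
    and Z_distr: "\<And>i. \<eta> \<noteq> 0 \<Longrightarrow> i \<ge> 1 \<Longrightarrow> distr M borel (Z i) = scale_measure (ennreal (1 / \<eta>)) \<rho>"
    and N_Z_indep: "\<eta> \<noteq> 0 \<Longrightarrow>
          prob_space.indep_set M (process_events M {0..} N) (process_events M {1..} Z)"
    and V: "\<And>t \<omega>. 0 \<le> t \<Longrightarrow> \<omega> \<in> space M \<Longrightarrow>
          V t \<omega> = (if \<eta> = 0 then 0 else (\<Sum>i = 1..N t \<omega>. Z i \<omega>))"
    and T: "\<And>\<omega>. \<omega> \<in> space M \<Longrightarrow>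
          T \<omega> = (if \<eta> = 0 then \<infinity> else Inf (ereal ` {t. 0 \<le> t \<and> N t \<omega> > 0}))"
    and X': "levy_process_with M X' \<mu>' (levy_exponent A L' b' h)"
    and X'_V_indep: "prob_space.indep_set M (process_events M {0..} X') (process_events M {0..} V)"
    and X: "\<And>t \<omega>. 0 \<le> t \<Longrightarrow> \<omega> \<in> space M \<Longrightarrow> X t \<omega> = X' t \<omega> + V t \<omega>"
  shows "levy_process_with M X \<mu> (levy_exponent A L b h) \<and>
    (\<forall>\<omega>\<in>space M. \<forall>t\<ge>0. ereal t < T \<omega> \<longrightarrow> X t \<omega> = X' t \<omega>) \<and>
    (\<forall>B\<in>sets borel. \<forall>t\<ge>0.
       measure M {\<omega> \<in> space M. X' t \<omega> \<in> B} \<le> exp (t * \<eta>) * measure M {\<omega> \<in> space M. X t \<omega> \<in> B})"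
proof -
  interpret prob_space M by fact
  have sL [measurable_cong]: "sets L = sets borel" using L by (simp add: levy_measure_def)
  have sets_\<rho> [measurable_cong]: "sets \<rho> = sets borel" by (simp add: \<rho> sL)
  then have space_\<rho>: "space \<rho> = UNIV" by (simp add: sets_eq_imp_space_eq)
  note g [measurable]
  have "emeasure \<rho> UNIV = (\<integral>\<^sup>+ x. ennreal (1 - g x) \<partial>L)"
    using sL by (simp add: \<rho> emeasure_density)
  also have "\<dots> \<le> (\<integral>\<^sup>+ x. ennreal (max (norm (h x *\<^sub>R x)) 1 * (1 - g x)) \<partial>L)"
  proof (intro nn_integral_mono ennreal_leI)
    show "1 - g x \<le> max (norm (h x *\<^sub>R x)) 1 * (1 - g x)" for x
      using A1[of x] mult_right_mono[of 1 "max (norm (h x *\<^sub>R x)) 1" "1 - g x"] by simp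
  qed
  finally have fin: "emeasure \<rho> UNIV < \<infinity>" using A2 by (rule le_less_trans)
  then have "finite_measure \<rho>" by (intro finite_measureI) (simp add: space_\<rho>)
  then interpret \<rho>: finite_measure \<rho> .
  have exponents: "levy_exponent A L b h z = levy_exponent A L' b' h z + (CLINT x|\<rho>. iexp (z \<bullet> x) - 1)" for z
    unfolding L' \<rho> by (rule levy_exponent_thinning[OF L h g A1 A2 b'])
  have \<eta>0: "0 \<le> \<eta>" by (simp add: \<eta>)
  \<comment> \<open>If \<open>\<eta> = 0\<close> then \<open>\<rho>\<close> is null and \<open>V\<close> vanishes; the three properties hold in both cases.\<close>
  have V_props: "levy_process M V \<and>
      (\<forall>t\<ge>0. \<forall>z. char_fn (distr M borel (V t)) z = exp (complex_of_real t * (CLINT x|\<rho>. iexp (z \<bullet> x) - 1))) \<and>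
      (\<forall>t\<ge>0. exp (- (t * \<eta>)) \<le> prob {\<omega> \<in> space M. V t \<omega> = 0})"
  proof (cases "\<eta> = 0")
    case True
    have V0: "V t \<omega> = 0" if "0 \<le> t" "\<omega> \<in> space M" for t \<omega>
      using V[OF that] True by simp
    have "emeasure \<rho> (space \<rho>) = 0"
      using True by (simp add: \<eta> \<rho>.emeasure_eq_measure space_\<rho>)
    then have int0: "(CLINT x|\<rho>. iexp (z \<bullet> x) - 1) = 0" for z
      by (intro integral_eq_zero_AE AE_I'[of "space \<rho>"]) (auto simp: null_sets_def)
    have "levy_process M V"
      by (rule levy_process_cong[OF levy_process_zero]) (simp add: V0)
    moreover have "char_fn (distr M borel (V t)) z = 1" if "0 \<le> t" for t z
    proof -
      have "distr M borel (V t) = distr M borel (\<lambda>_. 0)"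
        using V0[OF that] by (intro distr_cong) auto
      then show ?thesis by (simp only: char_fn_distr[OF borel_measurable_const]) (simp add: prob_space)
    qed
    moreover have "prob {\<omega> \<in> space M. V t \<omega> = 0} = 1" if "0 \<le> t" for t
    proof -
      have "{\<omega> \<in> space M. V t \<omega> = 0} = space M" using V0[OF that] by auto
      then show ?thesis by (simp add: prob_space)
    qed
    ultimately show ?thesis using True by (simp add: int0)
  next
    case False
    then have pos: "\<eta> > 0" using \<eta>0 by simp
    let ?\<nu> = "scale_measure (ennreal (1 / \<eta>)) \<rho>"
    interpret cp: compound_poisson M \<eta> ?\<nu> N Z
      by unfold_locales (use pos False N Z_indep Z_distr N_Z_indep in auto)
    have eq: "cp.jump_sum t \<omega> = V t \<omega>" if "0 \<le> t" "\<omega> \<in> space M" for t \<omega>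
      using V[OF that] False by (simp add: cp.jump_sum_def)
    have "\<eta> * (char_fn ?\<nu> z - 1) = (CLINT x|\<rho>. iexp (z \<bullet> x) - 1)" for z
    proof -
      have "char_fn ?\<nu> z = (CLINT x|\<rho>. (1 / \<eta>) *\<^sub>R iexp (z \<bullet> x))"
        unfolding char_fn_def scale_measure_eq_density using pos by (intro integral_density) auto
      moreover have "integrable \<rho> (\<lambda>x. iexp (z \<bullet> x))"
        by (rule \<rho>.integrable_const_bound[where B=1]) auto
      ultimately show ?thesis
        using pos by (simp add: \<eta> space_\<rho> scaleR_conv_of_real right_diff_distrib)
    qed
    then have \<eta>\<nu>: "complex_of_real (\<eta> * t) * (char_fn ?\<nu> z - 1) = complex_of_real t * (CLINT x|\<rho>. iexp (z \<bullet> x) - 1)" for t z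
      by (simp add: mult_ac)
    have "levy_process M V"
      by (rule levy_process_cong[OF cp.levy_process_jump_sum eq])
    moreover have "char_fn (distr M borel (V t)) z = exp (complex_of_real t * (CLINT x|\<rho>. iexp (z \<bullet> x) - 1))" if "0 \<le> t" for t z
    proof -
      have "distr M borel (V t) = distr M borel (cp.jump_sum t)"
        using eq[OF that] by (intro distr_cong) auto
      then show ?thesis by (simp only: cp.char_fn_jump_sum[OF that] \<eta>\<nu>)
    qed
    moreover have "exp (- (t * \<eta>)) \<le> prob {\<omega> \<in> space M. V t \<omega> = 0}" if "0 \<le> t" for t
    proof -
      have "{\<omega> \<in> space M. V t \<omega> = 0} = {\<omega> \<in> space M. cp.jump_sum t \<omega> = 0}" using eq[OF that] by auto
      then show ?thesis using cp.prob_jump_sum_zero_ge[OF that] by (simp add: mult_ac)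
    qed
    ultimately show ?thesis by blast
  qed
  have X'_levy: "levy_process M X'"
    and X'_char: "\<And>t z. 0 \<le> t \<Longrightarrow> char_fn (distr M borel (X' t)) z = exp (complex_of_real t * levy_exponent A L' b' h z)"
    using X' by (auto simp: levy_process_with_def)
  have X_levy: "levy_process M X"
    by (rule levy_process_cong[OF levy_process_add[OF X'_levy _ X'_V_indep]]) (use V_props X in auto)
  have rv: "X t \<in> borel_measurable M" "X' t \<in> borel_measurable M" "V t \<in> borel_measurable M" if "0 \<le> t" for t
    using X_levy X'_levy V_props that by (auto simp: levy_process_def)
  have X_char: "char_fn (distr M borel (X t)) z = exp (complex_of_real t * levy_exponent A L b h z)" if t: "0 \<le> t" for t z
  proof -
    have "distr M borel (X t) = distr M borel (\<lambda>\<omega>. X' t \<omega> + V t \<omega>)"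
      using X[OF t] by (intro distr_cong) auto
    also have "char_fn \<dots> z = char_fn (distr M borel (X' t)) z * char_fn (distr M borel (V t)) z"
      by (rule char_fn_add[where F="process_algebra M {0..} X'" and G="process_algebra M {0..} V"])
        (use X'_V_indep t in \<open>auto intro: measurable_process_algebra\<close>)
    also have "\<dots> = exp (complex_of_real t * levy_exponent A L b h z)"
      using X'_char[OF t] V_props t by (simp add: exponents exp_add distrib_left)
    finally show ?thesis .
  qed
  have X_1: "distr M borel (X 1) = \<mu>"
  proof (rule char_fn_unique)
    show "char_fn (distr M borel (X 1)) z = char_fn \<mu> z" for z
      using X_char[of 1 z] \<mu> by (simp add: is_ID_def)
    show "finite_measure (distr M borel (X 1))" "finite_measure \<mu>" "sets \<mu> = sets borel"
      using \<mu> rv(1)[of 1] by (auto simp: is_ID_def prob_space_def intro!: finite_measure_distr)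
  qed simp
  have "X t \<omega> = X' t \<omega>" if \<omega>: "\<omega> \<in> space M" and t: "0 \<le> t" and less: "ereal t < T \<omega>" for t \<omega>
  proof (cases "\<eta> = 0")
    case False
    then have "T \<omega> = Inf (ereal ` {t. 0 \<le> t \<and> N t \<omega> > 0})" using T[OF \<omega>] by simp
    with less have "\<not> (0 \<le> t \<and> N t \<omega> > 0)"
      by (metis (mono_tags, lifting) Inf_lower imageI leD mem_Collect_eq)
    then show ?thesis using X[OF t \<omega>] V[OF t \<omega>] t by simp
  qed (use X[OF t \<omega>] V[OF t \<omega>] in simp)
  moreover have "prob {\<omega> \<in> space M. X' t \<omega> \<in> B} \<le> exp (t * \<eta>) * prob {\<omega> \<in> space M. X t \<omega> \<in> B}"
    if B [measurable]: "B \<in> sets borel" and t: "0 \<le> t" for B t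
  proof -
    note rv[OF t, measurable]
    let ?C = "{\<omega> \<in> space M. X' t \<omega> \<in> B}" and ?D = "{\<omega> \<in> space M. V t \<omega> = 0}"
    have C: "?C \<in> process_events M {0..} X'"
    proof -
      have "X' t -` B \<inter> space M \<in> process_events M {0..} X'"
        using measurable_sets[OF measurable_process_algebra B, of t "{0..}" X' M] t by simp
      then show ?thesis by (simp add: vimage_def Int_def conj_commute)
    qed
    have D: "?D \<in> process_events M {0..} V"
    proof -
      have "V t -` {0} \<inter> space M \<in> process_events M {0..} V"
        using measurable_sets[OF measurable_process_algebra, of t "{0..}" "{0}" V M] t by simp
      then show ?thesis by (simp add: vimage_def Int_def conj_commute)
    qed
    \<comment> \<open>\<open>X'\<close> is independent of \<open>V\<close>, so the event is expressed through \<open>V t = 0\<close> and not through \<open>N t = 0\<close>.\<close>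
    have "prob ?C * exp (- (t * \<eta>)) \<le> prob ?C * prob ?D"
      using V_props t by (intro mult_left_mono) auto
    also have "\<dots> = prob (?C \<inter> ?D)"
      by (rule indep_setD[OF X'_V_indep C D, symmetric])
    also have "\<dots> \<le> prob {\<omega> \<in> space M. X t \<omega> \<in> B}"
      using X[OF t] by (intro finite_measure_mono) auto
    finally have "prob ?C * exp (- (t * \<eta>)) \<le> prob {\<omega> \<in> space M. X t \<omega> \<in> B}" .
    then show ?thesis by (simp add: exp_minus field_simps)
  qed
  ultimately show ?thesis
    using X_levy X_1 X_char by (simp add: levy_process_with_def)
qed

end
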